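(* Consider a family of $n$-qubit error-correcting codes for increasing $n$. Each code has a codespace $\mathsf C$ with code distance $d=d(n)$, a Poissonian noise model $\{E_\mu\}_{\mu=1}^N$ (unitary error operators), a recovery map $\mathcal R$, and a tolerable error weight $h=h(n)$ (defined in the context) with respect to the total error channel $\mathcal E=\frac1N\sum_{\mu=1}^N\mathcal E_\mu$, where $\mathcal E_\mu(\rho)=E_\mu\rho E_\mu^\dagger$. Then there exists a small parameter $\xi=2^{-\Omega(d)}$ such that the logical error probability $\epsilon(t)$ for the global decoder with recovery rate $\kappa$ and noise rate $\Delta$ satisfies, for every $t\ge0$, $$\epsilon(t)\le 1-\exp\left(-(1-\xi)N\Delta\left(\frac{N\Delta}{\kappa+N\Delta}\right)^{h}t-\xi(\kappa+N\Delta)t\right).$$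
   Context: For each $n$, $\mathsf H=(\mathbb C^2)^{\otimes n}$ and $\mathsf C\subset\mathsf H$ is a subspace (codespace). $N$, $\kappa>0$, $\Delta>0$ may depend on $n$. Noise. $\mathcal L_E(\rho)=\sum_{\mu=1}^N\lambda_\mu\big(E_\mu\rho E_\mu^\dagger-\tfrac12\{E_\mu^\dagger E_\mu,\rho\}\big)$ with $\lambda_\mu>0$, $\sum_\mu\lambda_\mu=N$. Poissonian noise means $E_\mu^\dagger E_\mu=I$ for all $\mu$. Recovery (global decoder). $\mathcal R$ is a CPTP map with output supported on $\mathsf C$, $\mathcal R^2=\mathcal R$, and $\mathcal R(\rho_0)=\rho_0$ for every density operator $\rho_0$ supported on $\mathsf C$. The recovery Lindbladian of the global decoder is $\mathcal L_R(\rho)=\kappa(\mathcal R(\rho)-\rho)$. The full dynamics is generated by $\mathcal L=\mathcal L_R+\Delta\mathcal L_E$. Logical error. $\epsilon(t)=1-\min_{|\psi_0\rangle\in\mathsf C}\mathrm{Tr}\big(|\psi_0\rangle\langle\psi_0|\,\mathcal R e^{\mathcal Lt}(|\psi_0\rangle\langle\psi_0|)\big)$, min over unit vectors. Tolerable error weight. For a code family with code distance $d(n)$, error channel $\mathcal E$ and recovery map $\mathcal R$, an integer-valued function $h=h(n)$ is a tolerable error weight if for every unit vector $|\psi\rangle\in\mathsf C$ and every non-negative integer $k\le h$, $\mathcal R\mathcal E^k(|\psi\rangle\langle\psi|)-(1-\xi)|\psi\rangle\langle\psi|\ge0$ (positive semidefinite), where $\xi=2^{-\Omega(d)}$ is independent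 of $|\psi\rangle$ (i.e. there is a constant $c>0$ with $\xi(n)\le2^{-c\,d(n)}$ for all sufficiently large $n$).
   Formalization: The total error channel is taken as (1/N) Σ λ_μ E_μ, weighted by the noise rates, not the uniform mixture; for all λ_μ = 1 this is the printed claim, while for general rates the uniform version fails (e.g. 2^n errors with nearly all the rate on one logical error). *)

theory Defs
  imports
    Complex_Main
    "Jordan_Normal_Form.Schur_Decomposition"
    "Jordan_Normal_Form.VS_Connect"
begin

text \<open>
  The space of \<open>n\<close> qubits is \<open>carrier_vec (2 ^ n)\<close> over \<open>complex\<close>; the basis index \<open>a < 2 ^ n\<close>
  stands for the computational basis state whose qubit \<open>q\<close> has the value \<open>(a div 2 ^ q) mod 2\<close>.
  Superoperators are functions on \<open>complex mat\<close>, of which only the values on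
  \<open>carrier_mat D D\<close> matter (\<open>D = 2 ^ n\<close>).  Order on \<open>complex\<close> is the one of
  \<open>HOL-Library.Complex_Order\<close>: \<open>0 \<le> z\<close> means that \<open>z\<close> is real and nonnegative.
\<close>

definition mat_trace :: "complex mat \<Rightarrow> complex" where
  "mat_trace A = (\<Sum>i<dim_row A. A $$ (i, i))"

definition psd :: "nat \<Rightarrow> complex mat \<Rightarrow> bool" where
  "psd D A \<longleftrightarrow> A \<in> carrier_mat D D \<and> (\<forall>v\<in>carrier_vec D. 0 \<le> (A *\<^sub>v v) \<bullet>c v)"

definition density_op :: "nat \<Rightarrow> complex mat \<Rightarrow> bool" where
  "density_op D \<rho> \<longleftrightarrow> psd D \<rho> \<and> mat_trace \<rho> = 1"

definition ketbra :: "complex vec \<Rightarrow> complex mat" where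
  "ketbra \<psi> = mat (dim_vec \<psi>) (dim_vec \<psi>) (\<lambda>(i, j). \<psi> $ i * cnj (\<psi> $ j))"

text \<open>For a Hermitian operator, the support is the range.\<close>

definition supported_on :: "nat \<Rightarrow> complex vec set \<Rightarrow> complex mat \<Rightarrow> bool" where
  "supported_on D C A \<longleftrightarrow> (\<forall>v\<in>carrier_vec D. A *\<^sub>v v \<in> C)"

abbreviation is_codespace :: "nat \<Rightarrow> complex vec set \<Rightarrow> bool" where
  "is_codespace n C \<equiv> VectorSpace.subspace class_ring C (module_vec TYPE(complex) (2 ^ n))"

datatype pauli = PauliI | PauliX | PauliY | PauliZ

fun pauli_mat :: "pauli \<Rightarrow> complex mat" where
  "pauli_mat PauliI = mat_of_rows_list 2 [[1, 0], [0, 1]]"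
| "pauli_mat PauliX = mat_of_rows_list 2 [[0, 1], [1, 0]]"
| "pauli_mat PauliY = mat_of_rows_list 2 [[0, - \<i>], [\<i>, 0]]"
| "pauli_mat PauliZ = mat_of_rows_list 2 [[1, 0], [0, -1]]"

text \<open>The tensor product of the Pauli matrices \<open>p q\<close> over the qubits \<open>q < n\<close>.\<close>

definition pauli_string :: "nat \<Rightarrow> (nat \<Rightarrow> pauli) \<Rightarrow> complex mat" where
  "pauli_string n p = mat (2 ^ n) (2 ^ n)
     (\<lambda>(a, b). \<Prod>q<n. pauli_mat (p q) $$ ((a div 2 ^ q) mod 2, (b div 2 ^ q) mod 2))"

definition pauli_weight :: "nat \<Rightarrow> (nat \<Rightarrow> pauli) \<Rightarrow> nat" where
  "pauli_weight n p = card {q. q < n \<and> p q \<noteq> PauliI}"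

text \<open>The Knill-Laflamme error detection condition.\<close>

definition detectable :: "complex vec set \<Rightarrow> complex mat \<Rightarrow> bool" where
  "detectable C P \<longleftrightarrow>
     (\<exists>c. \<forall>\<phi>\<in>C. \<forall>\<psi>\<in>C. (P *\<^sub>v \<psi>) \<bullet>c \<phi> = c * (\<psi> \<bullet>c \<phi>))"

text \<open>
  The distance is the least weight of an undetectable Pauli error.  It is a predicate because a
  code of dimension at most one, which stores no quantum information, has no undetectable error
  and hence no distance.
\<close>

definition has_code_distance :: "nat \<Rightarrow> complex vec set \<Rightarrow> nat \<Rightarrow> bool" where
  "has_code_distance n C d \<longleftrightarrow>
     (\<exists>p. pauli_weight n p = d \<and> \<not> detectable C (pauli_string n p)) \<and>
     (\<forall>p. pauli_weight n p < d \<longrightarrow> detectable C (pauli_string n p))"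

definition linear_superop :: "nat \<Rightarrow> (complex mat \<Rightarrow> complex mat) \<Rightarrow> bool" where
  "linear_superop D R \<longleftrightarrow>
     (\<forall>A\<in>carrier_mat D D. R A \<in> carrier_mat D D) \<and>
     (\<forall>A\<in>carrier_mat D D. \<forall>B\<in>carrier_mat D D. R (A + B) = R A + R B) \<and>
     (\<forall>c. \<forall>A\<in>carrier_mat D D. R (c \<cdot>\<^sub>m A) = c \<cdot>\<^sub>m R A)"

text \<open>
  The map \<open>id \<otimes> R\<close> on \<open>m \<times> m\<close> block matrices with \<open>D \<times> D\<close> blocks: \<open>R\<close> is applied to every block.
\<close>

definition ampliation ::
    "nat \<Rightarrow> nat \<Rightarrow> (complex mat \<Rightarrow> complex mat) \<Rightarrow> complex mat \<Rightarrow> complex mat" where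
  "ampliation m D R M = mat (m * D) (m * D)
     (\<lambda>(r, s). R (mat D D (\<lambda>(a, b). M $$ ((r div D) * D + a, (s div D) * D + b)))
                 $$ (r mod D, s mod D))"

definition completely_positive :: "nat \<Rightarrow> (complex mat \<Rightarrow> complex mat) \<Rightarrow> bool" where
  "completely_positive D R \<longleftrightarrow> (\<forall>m M. psd (m * D) M \<longrightarrow> psd (m * D) (ampliation m D R M))"

definition cptp :: "nat \<Rightarrow> (complex mat \<Rightarrow> complex mat) \<Rightarrow> bool" where
  "cptp D R \<longleftrightarrow> linear_superop D R \<and> completely_positive D R \<and>
     (\<forall>A\<in>carrier_mat D D. mat_trace (R A) = mat_trace A)"

definition recovery_map ::
    "nat \<Rightarrow> complex vec set \<Rightarrow> (complex mat \<Rightarrow> complex mat) \<Rightarrow> bool" where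
  "recovery_map D C R \<longleftrightarrow> cptp D R \<and>
     (\<forall>\<rho>. density_op D \<rho> \<longrightarrow> supported_on D C (R \<rho>)) \<and>
     (\<forall>A\<in>carrier_mat D D. R (R A) = R A) \<and>
     (\<forall>\<rho>. density_op D \<rho> \<and> supported_on D C \<rho> \<longrightarrow> R \<rho> = \<rho>)"

definition noise_model ::
    "nat \<Rightarrow> nat \<Rightarrow> (nat \<Rightarrow> real) \<Rightarrow> (nat \<Rightarrow> complex mat) \<Rightarrow> bool" where
  "noise_model D N lam E \<longleftrightarrow> 0 < N \<and>
     (\<forall>\<mu>\<in>{1..N}. 0 < lam \<mu> \<and> E \<mu> \<in> carrier_mat D D) \<and> (\<Sum>\<mu>=1..N. lam \<mu>) = real N"

definition poissonian :: "nat \<Rightarrow> nat \<Rightarrow> (nat \<Rightarrow> complex mat) \<Rightarrow> bool" where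
  "poissonian D N E \<longleftrightarrow> (\<forall>\<mu>\<in>{1..N}. mat_adjoint (E \<mu>) * E \<mu> = 1\<^sub>m D)"

definition mat_sum :: "nat \<Rightarrow> (nat \<Rightarrow> complex mat) \<Rightarrow> nat set \<Rightarrow> complex mat" where
  "mat_sum D f S = mat D D (\<lambda>(i, j). \<Sum>\<mu>\<in>S. f \<mu> $$ (i, j))"

text \<open>
  The total error channel.  The rates enter as weights, so that it is the jump part of the
  noise Lindbladian divided by \<open>N\<close>; for \<open>lam \<mu> = 1\<close> it is the uniform mixture of the maps
  \<open>\<rho> \<mapsto> E \<mu> \<rho> (E \<mu>)\<^sup>\<dagger>\<close>.
\<close>

definition error_channel ::
    "nat \<Rightarrow> nat \<Rightarrow> (nat \<Rightarrow> real) \<Rightarrow> (nat \<Rightarrow> complex mat) \<Rightarrow> complex mat \<Rightarrow> complex mat" where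
  "error_channel D N lam E \<rho> = (1 / of_nat N) \<cdot>\<^sub>m
     mat_sum D (\<lambda>\<mu>. complex_of_real (lam \<mu>) \<cdot>\<^sub>m (E \<mu> * \<rho> * mat_adjoint (E \<mu>))) {1..N}"

definition noise_lindbladian ::
    "nat \<Rightarrow> nat \<Rightarrow> (nat \<Rightarrow> real) \<Rightarrow> (nat \<Rightarrow> complex mat) \<Rightarrow> complex mat \<Rightarrow> complex mat" where
  "noise_lindbladian D N lam E \<rho> =
     mat_sum D (\<lambda>\<mu>. complex_of_real (lam \<mu>) \<cdot>\<^sub>m
       (E \<mu> * \<rho> * mat_adjoint (E \<mu>)
        - (1 / 2) \<cdot>\<^sub>m (mat_adjoint (E \<mu>) * E \<mu> * \<rho> + \<rho> * (mat_adjoint (E \<mu>) * E \<mu>)))) {1..N}"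

definition recovery_lindbladian ::
    "real \<Rightarrow> (complex mat \<Rightarrow> complex mat) \<Rightarrow> complex mat \<Rightarrow> complex mat" where
  "recovery_lindbladian \<kappa> R \<rho> = complex_of_real \<kappa> \<cdot>\<^sub>m (R \<rho> - \<rho>)"

definition full_lindbladian ::
    "nat \<Rightarrow> nat \<Rightarrow> (nat \<Rightarrow> real) \<Rightarrow> (nat \<Rightarrow> complex mat) \<Rightarrow> (complex mat \<Rightarrow> complex mat) \<Rightarrow>
     real \<Rightarrow> real \<Rightarrow> complex mat \<Rightarrow> complex mat" where
  "full_lindbladian D N lam E R \<kappa> \<Delta> \<rho> =
     recovery_lindbladian \<kappa> R \<rho> + complex_of_real \<Delta> \<cdot>\<^sub>m noise_lindbladian D N lam E \<rho>"

text \<open>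
  The exponential series of \<open>t L\<close> applied to \<open>\<rho>\<close>, summed entrywise; it converges for every
  linear \<open>L\<close> on \<open>D \<times> D\<close> matrices.
\<close>

definition superop_exp ::
    "nat \<Rightarrow> (complex mat \<Rightarrow> complex mat) \<Rightarrow> real \<Rightarrow> complex mat \<Rightarrow> complex mat" where
  "superop_exp D L t \<rho> = mat D D
     (\<lambda>(i, j). \<Sum>k. complex_of_real (t ^ k / fact k) * ((L ^^ k) \<rho>) $$ (i, j))"

text \<open>
  The infimum is a minimum, since the unit sphere of a finite-dimensional space is compact.
\<close>

definition logical_error ::
    "nat \<Rightarrow> complex vec set \<Rightarrow> (complex mat \<Rightarrow> complex mat) \<Rightarrow>
     (complex mat \<Rightarrow> complex mat) \<Rightarrow> real \<Rightarrow> real" where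
  "logical_error D C R L t =
     1 - (INF \<psi>\<in>{\<psi>\<in>C. \<psi> \<bullet>c \<psi> = 1}. Re (mat_trace (ketbra \<psi> * R (superop_exp D L t (ketbra \<psi>)))))"

text \<open>
  \<open>\<xi> = 2 powr (- \<Omega>(d))\<close> along the qubit numbers \<open>n \<in> I\<close> of a code family.
\<close>

definition exp_small_in :: "nat set \<Rightarrow> (nat \<Rightarrow> nat) \<Rightarrow> (nat \<Rightarrow> real) \<Rightarrow> bool" where
  "exp_small_in I d \<xi> \<longleftrightarrow> (\<forall>n\<in>I. 0 \<le> \<xi> n) \<and>
     (\<exists>c>0. \<exists>n0. \<forall>n\<in>I. n0 \<le> n \<longrightarrow> \<xi> n \<le> 2 powr (- c * real (d n)))"

definition tolerable_error_weight ::
    "nat set \<Rightarrow> (nat \<Rightarrow> nat) \<Rightarrow> (nat \<Rightarrow> complex vec set) \<Rightarrow>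
     (nat \<Rightarrow> complex mat \<Rightarrow> complex mat) \<Rightarrow> (nat \<Rightarrow> complex mat \<Rightarrow> complex mat) \<Rightarrow>
     (nat \<Rightarrow> int) \<Rightarrow> bool" where
  "tolerable_error_weight I d C \<E> R h \<longleftrightarrow>
     (\<exists>\<xi>. exp_small_in I d \<xi> \<and>
       (\<forall>n\<in>I. \<forall>\<psi>\<in>C n. \<forall>k. \<psi> \<bullet>c \<psi> = 1 \<longrightarrow> int k \<le> h n \<longrightarrow>
          psd (2 ^ n) (R n ((\<E> n ^^ k) (ketbra \<psi>))
                       - complex_of_real (1 - \<xi> n) \<cdot>\<^sub>m ketbra \<psi>)))"

end

theory Submission
  imports Defs
begin

text \<open>
  Put \<open>\<Lambda> = \<kappa> + N \<Delta>\<close> and \<open>p = N \<Delta> / \<Lambda>\<close>.  For Poissonian noise the full Lindbladian is \<open>\<Lambda> (M - id)\<close> with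
  \<open>M = (1 - p) R + p \<E>\<close>, so the evolution applies \<open>M\<close> a Poisson number of times with mean \<open>\<Lambda> t\<close>.
  A recovery that follows at most \<open>h\<close> errors restores the logical state up to a factor \<open>1 - \<xi>\<close> and a
  positive remainder.  Hence, with \<open>a = (1 - \<xi>) (1 - p ^ (h + 1))\<close>, the fidelity after \<open>k\<close>
  applications of \<open>M\<close> and a final recovery is at least \<open>a ^ k\<close>, and the Poisson average of \<open>a ^ k\<close>
  is \<open>exp (- \<Lambda> (1 - a) t)\<close>, which is the claimed bound because \<open>\<Lambda> p ^ (h + 1) = N \<Delta> p ^ h\<close>.
  For \<open>h < 0\<close> the event that nothing happens already gives \<open>exp (- \<Lambda> t)\<close>, which suffices.
\<close>

section \<open>Linear functionals on square matrices and their expansion in matrix units\<close>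

text \<open>Superoperators are later tested against such functionals, so that every convergence
  argument is about scalar series. As for superoperators, linearity is demanded only on
  \<open>carrier_mat D D\<close>.\<close>

definition linear_form :: "nat \<Rightarrow> (complex mat \<Rightarrow> complex) \<Rightarrow> bool" where
  "linear_form D F \<longleftrightarrow>
     (\<forall>A\<in>carrier_mat D D. \<forall>B\<in>carrier_mat D D. F (A + B) = F A + F B) \<and>
     (\<forall>c. \<forall>A\<in>carrier_mat D D. F (c \<cdot>\<^sub>m A) = c * F A)"

lemma linear_form_compose:
  "linear_form D F \<Longrightarrow> linear_superop D L \<Longrightarrow> linear_form D (\<lambda>A. F (L A))"
  by (auto simp: linear_form_def linear_superop_def)

lemma linear_superop_compose:
  "linear_superop D L \<Longrightarrow> linear_superop D M \<Longrightarrow> linear_superop D (\<lambda>A. L (M A))"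
  by (auto simp: linear_superop_def)

lemma linear_superop_funpow:
  assumes "linear_superop D L"
  shows "linear_superop D (L ^^ k)"
proof (induction k)
  case 0
  show ?case by (simp add: linear_superop_def)
next
  case (Suc k)
  then show ?case using linear_superop_compose[OF assms Suc] by (simp add: comp_def)
qed

lemma linear_superop_carrier:
  "linear_superop D L \<Longrightarrow> A \<in> carrier_mat D D \<Longrightarrow> L A \<in> carrier_mat D D"
  by (auto simp: linear_superop_def)

lemma linear_form_diff:
  assumes "linear_form D F" "A \<in> carrier_mat D D" "B \<in> carrier_mat D D"
  shows "F (A - B) = F A - F B"
proof -
  have "A - B = A + (-1) \<cdot>\<^sub>m B" using assms by (intro eq_matI) auto
  then show ?thesis using assms by (simp add: linear_form_def)
qed

lemma linear_form_mat_sum: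
  assumes F: "linear_form D F" and "finite S" and "\<And>\<mu>. \<mu> \<in> S \<Longrightarrow> f \<mu> \<in> carrier_mat D D"
  shows "F (mat_sum D f S) = (\<Sum>\<mu>\<in>S. F (f \<mu>))"
  using assms(2,3)
proof (induction S rule: finite_induct)
  case empty
  \<comment> \<open>The empty sum is written as a multiple by zero, so homogeneity alone gives the
    value zero.\<close>
  have "mat_sum D f {} = 0 \<cdot>\<^sub>m 0\<^sub>m D D" by (intro eq_matI) (auto simp: mat_sum_def)
  moreover have "F (0 \<cdot>\<^sub>m 0\<^sub>m D D) = 0 * F (0\<^sub>m D D)"
    using F zero_carrier_mat unfolding linear_form_def by blast
  ultimately show ?case by simp
next
  case (insert x S)
  have c: "mat_sum D f S \<in> carrier_mat D D" by (simp add: mat_sum_def)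
  have "mat_sum D f (insert x S) = f x + mat_sum D f S"
    using insert(1,2) insert(4)[of x] by (intro eq_matI) (auto simp: mat_sum_def)
  then show ?case using F c insert by (simp add: linear_form_def)
qed

lemma linear_form_entry:
  "i < D \<Longrightarrow> j < D \<Longrightarrow> linear_form D (\<lambda>A. A $$ (i, j))"
  by (auto simp: linear_form_def)

lemma linear_form_expectation:
  assumes v: "v \<in> carrier_vec D"
  shows "linear_form D (\<lambda>A. (A *\<^sub>v v) \<bullet>c v)"
proof -
  have "((A + B) *\<^sub>v v) \<bullet>c v = (A *\<^sub>v v) \<bullet>c v + (B *\<^sub>v v) \<bullet>c v"
    if "A \<in> carrier_mat D D" "B \<in> carrier_mat D D" for A B
    using that v by (simp add: add_mult_distrib_mat_vec add_scalar_prod_distrib[where n = D])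
  moreover have "((c \<cdot>\<^sub>m A) *\<^sub>v v) \<bullet>c v = c * ((A *\<^sub>v v) \<bullet>c v)"
    if "A \<in> carrier_mat D D" for c A
  proof -
    have "(c \<cdot>\<^sub>m A) *\<^sub>v v = c \<cdot>\<^sub>v (A *\<^sub>v v)" using that v by (intro eq_vecI) auto
    then show ?thesis using that v by simp
  qed
  ultimately show ?thesis by (simp add: linear_form_def)
qed

definition unit_mat_at :: "nat \<Rightarrow> nat \<Rightarrow> nat \<Rightarrow> complex mat" where
  "unit_mat_at D i j = mat D D (\<lambda>p. if p = (i, j) then 1 else 0)"

text \<open>The matrix units span, so a functional is a finite combination of entry evaluations.
  Boundedness and the exchange with an infinite series thereby reduce to single entries.\<close>

lemma linear_form_expand:
  assumes F: "linear_form D F" and A: "A \<in> carrier_mat D D"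
  shows "F A = (\<Sum>i<D. \<Sum>j<D. A $$ (i, j) * F (unit_mat_at D i j))"
proof -
  let ?row = "\<lambda>i. mat_sum D (\<lambda>j. A $$ (i, j) \<cdot>\<^sub>m unit_mat_at D i j) {..<D}"
  have u: "unit_mat_at D i j \<in> carrier_mat D D" for i j by (simp add: unit_mat_at_def)
  have r: "?row i \<in> carrier_mat D D" for i by (simp add: mat_sum_def)
  have "A = mat_sum D ?row {..<D}"
  proof (intro eq_matI)
    fix a b assume ab: "a < dim_row (mat_sum D ?row {..<D})" "b < dim_col (mat_sum D ?row {..<D})"
    then have ab: "a < D" "b < D" by (auto simp: mat_sum_def)
    have "(\<Sum>j<D. A $$ (i, j) * (if (a, b) = (i, j) then 1 else 0)) = (if a = i then A $$ (a, b) else 0)" for i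
      using ab by (cases "a = i") (simp_all add: if_distrib cong: if_cong)
    then show "A $$ (a, b) = mat_sum D ?row {..<D} $$ (a, b)"
      using ab by (simp add: mat_sum_def unit_mat_at_def)
  qed (use A in \<open>auto simp: mat_sum_def\<close>)
  then have "F A = F (mat_sum D ?row {..<D})" by simp
  also have "\<dots> = (\<Sum>i<D. \<Sum>j<D. F (A $$ (i, j) \<cdot>\<^sub>m unit_mat_at D i j))"
    using u r by (simp add: linear_form_mat_sum[OF F])
  also have "\<dots> = (\<Sum>i<D. \<Sum>j<D. A $$ (i, j) * F (unit_mat_at D i j))"
    using F u by (simp add: linear_form_def)
  finally show ?thesis .
qed

section \<open>Bounds and convergence of the exponential series\<close>

text \<open>Boundedness for the maximum norm on entries. Any common bound \<open>B\<close> stands in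
  for the norm, which avoids a maximum over an index set that may be empty.\<close>

lemma linear_form_bounded:
  assumes F: "linear_form D F"
  obtains K where "0 \<le> K"
    "\<And>A B. A \<in> carrier_mat D D \<Longrightarrow> (\<And>i j. i < D \<Longrightarrow> j < D \<Longrightarrow> cmod (A $$ (i, j)) \<le> B) \<Longrightarrow>
       cmod (F A) \<le> K * B"
proof
  let ?K = "\<Sum>i<D. \<Sum>j<D. cmod (F (unit_mat_at D i j))"
  show "0 \<le> ?K" by (intro sum_nonneg) auto
  fix A B assume A: "A \<in> carrier_mat D D"
    and B: "\<And>i j. i < D \<Longrightarrow> j < D \<Longrightarrow> cmod (A $$ (i, j)) \<le> B"
  have "cmod (F A) \<le> (\<Sum>i<D. cmod (\<Sum>j<D. A $$ (i, j) * F (unit_mat_at D i j)))"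
    unfolding linear_form_expand[OF F A] by (rule norm_sum)
  also have "\<dots> \<le> (\<Sum>i<D. \<Sum>j<D. cmod (F (unit_mat_at D i j)) * B)"
    by (intro sum_mono order.trans[OF norm_sum])
       (simp add: norm_mult B mult.commute[of _ B] mult_right_mono)
  finally show "cmod (F A) \<le> ?K * B" by (simp add: sum_distrib_right)
qed

text \<open>Each entry of \<open>L A\<close> is a linear functional of \<open>A\<close>; the sum of
  the constants of all entries is one constant that serves everywhere and can be iterated.\<close>

lemma linear_superop_bounded:
  assumes L: "linear_superop D L"
  obtains K where "0 \<le> K"
    "\<And>A B i j. A \<in> carrier_mat D D \<Longrightarrow> (\<And>i j. i < D \<Longrightarrow> j < D \<Longrightarrow> cmod (A $$ (i, j)) \<le> B) \<Longrightarrow>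
       i < D \<Longrightarrow> j < D \<Longrightarrow> cmod (L A $$ (i, j)) \<le> K * B"
proof -
  have "\<exists>K\<ge>0. \<forall>A B. A \<in> carrier_mat D D \<longrightarrow> (\<forall>i<D. \<forall>j<D. cmod (A $$ (i, j)) \<le> B) \<longrightarrow>
      cmod (L A $$ (a, b)) \<le> K * B" if ab: "a < D" "b < D" for a b
    using linear_form_bounded[OF linear_form_compose[OF linear_form_entry[OF ab] L]] by metis
  then obtain K where K0: "\<And>a b. a < D \<Longrightarrow> b < D \<Longrightarrow> 0 \<le> K a b" and K:
    "\<And>a b A B. a < D \<Longrightarrow> b < D \<Longrightarrow> A \<in> carrier_mat D D \<Longrightarrow>
       (\<forall>i<D. \<forall>j<D. cmod (A $$ (i, j)) \<le> B) \<Longrightarrow> cmod (L A $$ (a, b)) \<le> K a b * B"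
    by metis
  let ?K = "\<Sum>a<D. \<Sum>b<D. K a b"
  show ?thesis
  proof
    show "0 \<le> ?K" by (intro sum_nonneg K0) auto
    fix A B i j assume A: "A \<in> carrier_mat D D" and ij: "i < D" "j < D"
      and B: "\<And>i j. i < D \<Longrightarrow> j < D \<Longrightarrow> cmod (A $$ (i, j)) \<le> B"
    \<comment> \<open>An entry exists here, so its bound forces \<open>B\<close> to be
      nonnegative.\<close>
    have B0: "0 \<le> B" using B[OF ij] norm_ge_zero order.trans by blast
    have "K i j \<le> (\<Sum>b<D. K i b)" using ij by (intro member_le_sum K0) auto
    also have "\<dots> \<le> ?K" using ij
      by (intro member_le_sum[where f = "\<lambda>a. \<Sum>b<D. K a b"] sum_nonneg K0) auto
    finally have "K i j * B \<le> ?K * B" using B0 by (rule mult_right_mono)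
    then show "cmod (L A $$ (i, j)) \<le> ?K * B" using K[OF ij A] B by force
  qed
qed

text \<open>Each application of \<open>L\<close> costs one factor \<open>K\<close> in the entrywise
  bound, so the iterates grow at most geometrically.\<close>

lemma linear_form_funpow_bounded:
  assumes F: "linear_form D F" and L: "linear_superop D L" and A: "A \<in> carrier_mat D D"
  obtains c K where "0 \<le> K" "\<And>k. cmod (F ((L ^^ k) A)) \<le> c * K ^ k"
proof -
  obtain K where K0: "0 \<le> K" and K:
    "\<And>A B i j. A \<in> carrier_mat D D \<Longrightarrow> (\<And>i j. i < D \<Longrightarrow> j < D \<Longrightarrow> cmod (A $$ (i, j)) \<le> B) \<Longrightarrow>
       i < D \<Longrightarrow> j < D \<Longrightarrow> cmod (L A $$ (i, j)) \<le> K * B"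
    using linear_superop_bounded[OF L] by metis
  obtain c where c0: "0 \<le> c" and c:
    "\<And>A B. A \<in> carrier_mat D D \<Longrightarrow> (\<And>i j. i < D \<Longrightarrow> j < D \<Longrightarrow> cmod (A $$ (i, j)) \<le> B) \<Longrightarrow>
       cmod (F A) \<le> c * B"
    using linear_form_bounded[OF F] by metis
  let ?B = "\<Sum>a<D. \<Sum>b<D. cmod (A $$ (a, b))"
  have car: "(L ^^ k) A \<in> carrier_mat D D" for k
    using linear_superop_carrier[OF linear_superop_funpow[OF L] A] .
  have entry: "cmod ((L ^^ k) A $$ (i, j)) \<le> K ^ k * ?B" if ij: "i < D" "j < D" for k i j
    using ij
  proof (induction k arbitrary: i j)
    case 0
    have "cmod (A $$ (i, j)) \<le> (\<Sum>b<D. cmod (A $$ (i, b)))"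
      using 0 by (intro member_le_sum) auto
    also have "\<dots> \<le> ?B" using 0
      by (intro member_le_sum[where f = "\<lambda>a. \<Sum>b<D. cmod (A $$ (a, b))"] sum_nonneg) auto
    finally show ?case by simp
  next
    case (Suc k)
    from K[OF car Suc.IH Suc.prems] show ?case by (simp add: mult.assoc)
  qed
  have "cmod (F ((L ^^ k) A)) \<le> (c * ?B) * K ^ k" for k
    using c[OF car entry] by (simp add: mult_ac)
  then show ?thesis using that K0 by blast
qed

text \<open>The factorial dominates the geometric growth of the iterates. Summability is absolute
  because the Cauchy product in \<open>superop_exp_poisson\<close> requires it.\<close>

lemma summable_exp_funpow:
  assumes F: "linear_form D F" and L: "linear_superop D L" and A: "A \<in> carrier_mat D D"
  shows "summable (\<lambda>k. cmod (complex_of_real (t ^ k / fact k) * F ((L ^^ k) A)))"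
proof -
  obtain c K where K0: "0 \<le> K" and K: "\<And>k. cmod (F ((L ^^ k) A)) \<le> c * K ^ k"
    using linear_form_funpow_bounded[OF assms] by blast
  have s: "summable (\<lambda>k. c * ((\<bar>t\<bar> * K) ^ k / fact k))"
    using summable_exp[of "\<bar>t\<bar> * K"] by (intro summable_mult) (simp add: field_simps)
  show ?thesis
  proof (rule summable_comparison_test'[OF s])
    fix k :: nat
    have "\<bar>t\<bar> ^ k / fact k * cmod (F ((L ^^ k) A)) \<le> \<bar>t\<bar> ^ k / fact k * (c * K ^ k)"
      by (intro mult_left_mono K) auto
    then show "norm (cmod (complex_of_real (t ^ k / fact k) * F ((L ^^ k) A)))
        \<le> c * ((\<bar>t\<bar> * K) ^ k / fact k)"
      by (simp add: norm_mult norm_divide norm_power power_mult_distrib mult_ac)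
  qed
qed

lemma superop_exp_carrier: "superop_exp D L t A \<in> carrier_mat D D"
  by (simp add: superop_exp_def)

text \<open>The exponential is defined entry by entry and a functional is a finite combination of
  entries, so the finite sums may be moved inside the series.\<close>

lemma linear_form_superop_exp:
  assumes F: "linear_form D F" and L: "linear_superop D L" and A: "A \<in> carrier_mat D D"
  shows "F (superop_exp D L t A) = (\<Sum>k. complex_of_real (t ^ k / fact k) * F ((L ^^ k) A))"
proof -
  have car: "(L ^^ k) A \<in> carrier_mat D D" for k
    using linear_superop_carrier[OF linear_superop_funpow[OF L] A] .
  let ?u = "\<lambda>i j. F (unit_mat_at D i j)"
  let ?e = "\<lambda>k i j. complex_of_real (t ^ k / fact k) * (L ^^ k) A $$ (i, j)"
  have s: "summable (\<lambda>k. ?e k i j)" if "i < D" "j < D" for i j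
    using summable_norm_cancel[OF summable_exp_funpow[OF linear_form_entry[OF that] L A]] .
  have "F (superop_exp D L t A) = (\<Sum>i<D. \<Sum>j<D. (\<Sum>k. ?e k i j) * ?u i j)"
    unfolding linear_form_expand[OF F superop_exp_carrier] by (simp add: superop_exp_def)
  also have "\<dots> = (\<Sum>i<D. \<Sum>j<D. (\<Sum>k. ?e k i j * ?u i j))"
    by (intro sum.cong refl suminf_mult2 s) auto
  also have "\<dots> = (\<Sum>i<D. (\<Sum>k. \<Sum>j<D. ?e k i j * ?u i j))"
    by (intro sum.cong refl suminf_sum[symmetric] summable_mult2 s) auto
  also have "\<dots> = (\<Sum>k. \<Sum>i<D. \<Sum>j<D. ?e k i j * ?u i j)"
    by (intro suminf_sum[symmetric] summable_sum summable_mult2 s) auto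
  also have "\<dots> = (\<Sum>k. complex_of_real (t ^ k / fact k) * F ((L ^^ k) A))"
    by (simp add: linear_form_expand[OF F car] sum_distrib_left mult_ac)
  finally show ?thesis .
qed

section \<open>Uniformization: the exponential as a Poisson mixture\<close>

text \<open>From \<open>L = c (M - id)\<close> follows \<open>c M = c id + L\<close>, and the two
  summands commute, so the power expands by the binomial theorem. The induction generalizes over
  \<open>A\<close> because its step uses the hypothesis for both \<open>A\<close> and
  \<open>L A\<close>.\<close>

lemma funpow_binomial:
  assumes F: "linear_form D F" and L: "linear_superop D L" and M: "linear_superop D M"
    and LM: "\<And>A. A \<in> carrier_mat D D \<Longrightarrow> L A = c \<cdot>\<^sub>m (M A - A)" and A: "A \<in> carrier_mat D D"
  shows "c ^ m * F ((M ^^ m) A) = (\<Sum>i\<le>m. of_nat (m choose i) * c ^ (m - i) * F ((L ^^ i) A))"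
  using A
proof (induction m arbitrary: A)
  case 0
  then show ?case by simp
next
  case (Suc m)
  note A = Suc.prems
  have FM: "linear_form D (\<lambda>A. F ((M ^^ m) A))"
    by (rule linear_form_compose[OF F linear_superop_funpow[OF M]])
  have c: "M A \<in> carrier_mat D D" "L A \<in> carrier_mat D D"
    using A L M by (auto intro: linear_superop_carrier)
  let ?g = "\<lambda>i. F ((L ^^ i) A)"
  let ?w = "\<lambda>i. of_nat (m choose i) * c ^ (m - i)"
  \<comment> \<open>The factor \<open>c M\<close> that acts on \<open>A\<close> first is traded for
    \<open>L + c id\<close>.\<close>
  have "F ((M ^^ m) (L A)) = c * (F ((M ^^ m) (M A)) - F ((M ^^ m) A))"
  proof -
    have "F ((M ^^ m) (c \<cdot>\<^sub>m (M A - A))) = c * F ((M ^^ m) (M A - A))"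
      using FM c(1) A minus_carrier_mat[OF A] unfolding linear_form_def by blast
    then show ?thesis using c(1) A by (simp add: LM linear_form_diff[OF FM])
  qed
  then have "F ((M ^^ m) (L A)) + c * F ((M ^^ m) A) = c * F ((M ^^ m) (M A))"
    by (simp add: algebra_simps)
  from arg_cong[OF this, of "\<lambda>x. c ^ m * x"]
  have "c ^ Suc m * F ((M ^^ Suc m) A)
      = c * (c ^ m * F ((M ^^ m) A)) + c ^ m * F ((M ^^ m) (L A))"
    by (simp add: funpow_Suc_right algebra_simps del: funpow.simps)
  also have "\<dots> = (\<Sum>i\<le>m. c * ?w i * ?g i) + (\<Sum>i\<le>m. ?w i * ?g (Suc i))"
    unfolding Suc.IH[OF A] Suc.IH[OF c(2)]
    by (simp add: funpow_Suc_right sum_distrib_left mult.assoc del: funpow.simps)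
  \<comment> \<open>Both sums are brought to the range up to \<open>Suc m\<close>: the first gains a
    term whose binomial coefficient vanishes, the second is shifted and gains a zero term at index
    0. Adding them is Pascal's rule.\<close>
  also have "(\<Sum>i\<le>m. c * ?w i * ?g i)
      = (\<Sum>i\<le>Suc m. of_nat (m choose i) * c ^ (Suc m - i) * ?g i)"
    by (simp add: binomial_eq_0 Suc_diff_le mult_ac)
  also have "(\<Sum>i\<le>m. ?w i * ?g (Suc i)) =
      (\<Sum>i\<le>Suc m. (if i = 0 then 0 else of_nat (m choose (i - 1))) * c ^ (Suc m - i) * ?g i)"
    by (simp add: sum.atMost_Suc_shift del: sum.atMost_Suc funpow.simps)
  also have "(\<Sum>i\<le>Suc m. of_nat (m choose i) * c ^ (Suc m - i) * ?g i) + \<dots>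
      = (\<Sum>i\<le>Suc m. of_nat (Suc m choose i) * c ^ (Suc m - i) * ?g i)"
    unfolding sum.distrib[symmetric]
    by (intro sum.cong refl) (auto simp: algebra_simps gr0_conv_Suc)
  finally show ?case .
qed

text \<open>Since \<open>c M = L + c id\<close>, the exponential of \<open>c t M\<close> is that of
  \<open>t L\<close> times the scalar \<open>exp (c * t)\<close>. The series is the Cauchy product
  of these two factors, and \<open>funpow_binomial\<close> identifies its coefficients.\<close>

lemma superop_exp_poisson:
  assumes F: "linear_form D F" and L: "linear_superop D L" and M: "linear_superop D M"
    and LM: "\<And>A. A \<in> carrier_mat D D \<Longrightarrow> L A = complex_of_real c \<cdot>\<^sub>m (M A - A)"
    and A: "A \<in> carrier_mat D D"
  shows "(\<lambda>m. complex_of_real ((c * t) ^ m / fact m) * F ((M ^^ m) A))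
    sums (F (superop_exp D L t A) * complex_of_real (exp (c * t)))"
proof -
  let ?a = "\<lambda>k. complex_of_real (t ^ k / fact k) * F ((L ^^ k) A)"
  let ?b = "\<lambda>k. complex_of_real ((c * t) ^ k / fact k)"
  have b: "summable (\<lambda>k. norm (?b k))"
    using summable_norm_exp[of "c * t"] by (simp add: divide_inverse mult_ac norm_mult norm_inverse norm_power del: of_real_mult)
  have bs: "(\<Sum>k. ?b k) = complex_of_real (exp (c * t))"
  proof -
    have "(\<lambda>k. (c * t) ^ k / fact k) sums exp (c * t)"
      using exp_converges[of "c * t"] by (simp add: divide_inverse mult_ac)
    from sums_of_real[OF this] show ?thesis by (rule sums_unique[symmetric])
  qed
  have "(\<lambda>m. \<Sum>i\<le>m. ?a i * ?b (m - i)) sums ((\<Sum>k. ?a k) * (\<Sum>k. ?b k))"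
    by (rule Cauchy_product_sums[OF summable_exp_funpow[OF F L A] b])
  moreover have "(\<Sum>i\<le>m. ?a i * ?b (m - i)) = complex_of_real ((c * t) ^ m / fact m) * F ((M ^^ m) A)" for m
  proof -
    have "?a i * ?b (m - i) = complex_of_real (t ^ m / fact m) *
        (of_nat (m choose i) * complex_of_real c ^ (m - i) * F ((L ^^ i) A))" if "i \<le> m" for i
    proof -
      have p: "t ^ m = t ^ i * t ^ (m - i)" using that by (simp flip: power_add)
      \<comment> \<open>Only \<open>t ^ m / fact m\<close> is factored out; the power of
        \<open>c\<close> depends on \<open>i\<close> and belongs to the binomial expansion.\<close>
      have "(t ^ i / fact i) * ((c * t) ^ (m - i) / fact (m - i)) =
          (t ^ m / fact m) * (real (m choose i) * c ^ (m - i))"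
        unfolding p binomial_fact[OF that, where 'a = real] by (simp add: power_mult_distrib)
      then have "complex_of_real (t ^ i / fact i) * complex_of_real ((c * t) ^ (m - i) / fact (m - i))
          = complex_of_real (t ^ m / fact m) * (of_nat (m choose i) * complex_of_real c ^ (m - i))"
        by (metis of_real_mult of_real_of_nat_eq of_real_power)
      from arg_cong[OF this, of "\<lambda>z. z * F ((L ^^ i) A)"] show ?thesis by (simp only: mult_ac)
    qed
    then have "(\<Sum>i\<le>m. ?a i * ?b (m - i)) = (\<Sum>i\<le>m. complex_of_real (t ^ m / fact m) *
        (of_nat (m choose i) * complex_of_real c ^ (m - i) * F ((L ^^ i) A)))"
      by (intro sum.cong refl) simp_all
    also have "\<dots> = complex_of_real (t ^ m / fact m) * (complex_of_real c ^ m * F ((M ^^ m) A))"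
    proof -
      have "complex_of_real c ^ m * F ((M ^^ m) A)
        = (\<Sum>i\<le>m. of_nat (m choose i) * complex_of_real c ^ (m - i) * F ((L ^^ i) A))"
        by (rule funpow_binomial[OF F L M _ A]) (rule LM)
      then show ?thesis by (simp only: sum_distrib_left)
    qed
    finally have "(\<Sum>i\<le>m. ?a i * ?b (m - i)) =
        complex_of_real (t ^ m / fact m) * (complex_of_real c ^ m * F ((M ^^ m) A))" .
    then show ?thesis by (simp add: power_mult_distrib mult_ac)
  qed
  ultimately show ?thesis unfolding bs linear_form_superop_exp[OF F L A] by simp
qed

section \<open>Closure properties of linear superoperators\<close>

lemma linear_superop_smult:
  assumes "linear_superop D L"
  shows "linear_superop D (\<lambda>A. c \<cdot>\<^sub>m L A)"
proof -
  have "c \<cdot>\<^sub>m (b \<cdot>\<^sub>m A) = b \<cdot>\<^sub>m (c \<cdot>\<^sub>m A)" for b and A :: "complex mat"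
    by (intro eq_matI) auto
  then show ?thesis
    using assms by (simp add: linear_superop_def add_smult_distrib_left_mat[where nr = D and nc = D])
qed

lemma linear_superop_add:
  assumes "linear_superop D L" "linear_superop D M"
  shows "linear_superop D (\<lambda>A. L A + M A)"
proof -
  have "A + B + (A' + B') = A + A' + (B + B')"
    if "A \<in> carrier_mat D D" "B \<in> carrier_mat D D" "A' \<in> carrier_mat D D" "B' \<in> carrier_mat D D"
    for A B A' B' :: "complex mat"
    using that by (intro eq_matI) auto
  then show ?thesis
    using assms unfolding linear_superop_def
    by (simp add: add_smult_distrib_left_mat[where nr = D and nc = D] del: assoc_add_mat)
qed

lemma linear_superop_mat_sum:
  assumes f: "\<And>\<mu>. \<mu> \<in> S \<Longrightarrow> linear_superop D (f \<mu>)"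
  shows "linear_superop D (\<lambda>A. mat_sum D (\<lambda>\<mu>. f \<mu> A) S)"
  unfolding linear_superop_def
proof (intro conjI ballI allI)
  fix A B :: "complex mat" assume A: "A \<in> carrier_mat D D" and B: "B \<in> carrier_mat D D"
  have c: "f \<mu> A \<in> carrier_mat D D" "f \<mu> B \<in> carrier_mat D D" if "\<mu> \<in> S" for \<mu>
    using f[OF that] A B by (auto intro: linear_superop_carrier)
  show "mat_sum D (\<lambda>\<mu>. f \<mu> A) S \<in> carrier_mat D D" by (simp add: mat_sum_def)
  have "f \<mu> (A + B) $$ (i, j) = f \<mu> A $$ (i, j) + f \<mu> B $$ (i, j)"
    if "\<mu> \<in> S" "i < D" "j < D" for \<mu> i j
  proof -
    have "f \<mu> (A + B) = f \<mu> A + f \<mu> B" using f[OF that(1)] A B by (simp add: linear_superop_def)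
    then show ?thesis using c[OF that(1)] that by simp
  qed
  then show "mat_sum D (\<lambda>\<mu>. f \<mu> (A + B)) S = mat_sum D (\<lambda>\<mu>. f \<mu> A) S + mat_sum D (\<lambda>\<mu>. f \<mu> B) S"
    by (intro eq_matI) (simp_all add: mat_sum_def sum.distrib)
  have "f \<mu> (c \<cdot>\<^sub>m A) $$ (i, j) = c * f \<mu> A $$ (i, j)"
    if "\<mu> \<in> S" "i < D" "j < D" for \<mu> i j c
  proof -
    have "f \<mu> (c \<cdot>\<^sub>m A) = c \<cdot>\<^sub>m f \<mu> A" using f[OF that(1)] A by (simp add: linear_superop_def)
    then show ?thesis using c[OF that(1)] that by simp
  qed
  then show "mat_sum D (\<lambda>\<mu>. f \<mu> (c \<cdot>\<^sub>m A)) S = c \<cdot>\<^sub>m mat_sum D (\<lambda>\<mu>. f \<mu> A) S" for c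
    by (intro eq_matI) (simp_all add: mat_sum_def sum_distrib_left)
qed

lemma linear_superop_sandwich:
  assumes K: "K \<in> carrier_mat D D" and K': "K' \<in> carrier_mat D D"
  shows "linear_superop D (\<lambda>A. K * A * K')"
  unfolding linear_superop_def
proof (intro conjI ballI allI)
  fix A B :: "complex mat" assume A: "A \<in> carrier_mat D D" and B: "B \<in> carrier_mat D D"
  show "K * A * K' \<in> carrier_mat D D" using K K' A by simp
  show "K * (A + B) * K' = K * A * K' + K * B * K'"
    using K K' A B by (simp add: mult_add_distrib_mat[OF K A B] add_mult_distrib_mat[where nr = D and nc = D and n = D])
  show "K * (c \<cdot>\<^sub>m A) * K' = c \<cdot>\<^sub>m (K * A * K')" for c
    using K K' A by (simp add: mult_smult_distrib[OF K A] mult_smult_assoc_mat[where nr = D and n = D and nc = D])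
qed

section \<open>Positive semidefinite matrices and positive maps\<close>

lemma psd_carrier: "psd D A \<Longrightarrow> A \<in> carrier_mat D D"
  by (simp add: psd_def)

lemma psd_smult:
  assumes "0 \<le> c" "psd D A"
  shows "psd D (complex_of_real c \<cdot>\<^sub>m A)"
  unfolding psd_def
proof (intro conjI ballI)
  show "complex_of_real c \<cdot>\<^sub>m A \<in> carrier_mat D D" using assms by (simp add: psd_def)
  fix v :: "complex vec" assume v: "v \<in> carrier_vec D"
  show "0 \<le> ((complex_of_real c \<cdot>\<^sub>m A) *\<^sub>v v) \<bullet>c v"
    using linear_form_expectation[OF v] assms v
    by (simp add: linear_form_def psd_def less_eq_complex_def)
qed

lemma psd_add:
  assumes "psd D A" "psd D B"
  shows "psd D (A + B)"
  using assms linear_form_expectation unfolding psd_def linear_form_def by auto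

lemma psd_mat_sum:
  assumes "finite S" and f: "\<And>\<mu>. \<mu> \<in> S \<Longrightarrow> psd D (f \<mu>)"
  shows "psd D (mat_sum D f S)"
  unfolding psd_def
proof (intro conjI ballI)
  show "mat_sum D f S \<in> carrier_mat D D" by (simp add: mat_sum_def)
  fix v :: "complex vec" assume v: "v \<in> carrier_vec D"
  have "(mat_sum D f S *\<^sub>v v) \<bullet>c v = (\<Sum>\<mu>\<in>S. (f \<mu> *\<^sub>v v) \<bullet>c v)"
    by (rule linear_form_mat_sum[OF linear_form_expectation[OF v] assms(1)]) (rule psd_carrier[OF f])
  then show "0 \<le> (mat_sum D f S *\<^sub>v v) \<bullet>c v"
    using f v by (auto simp: psd_def intro!: sum_nonneg)
qed

lemma mat_adjoint_carrier: "K \<in> carrier_mat D D \<Longrightarrow> mat_adjoint K \<in> carrier_mat D D"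
  by (auto simp: mat_adjoint_def mat_of_rows_def)

lemma scalar_prod_mat_adjoint:
  fixes K :: "complex mat"
  assumes K: "K \<in> carrier_mat D D" and x: "x \<in> carrier_vec D" and v: "v \<in> carrier_vec D"
  shows "(K *\<^sub>v x) \<bullet>c v = x \<bullet>c (mat_adjoint K *\<^sub>v v)"
proof -
  have "(K *\<^sub>v x) \<bullet>c v = (\<Sum>i\<in>{0..<D}. \<Sum>j\<in>{0..<D}. K $$ (i, j) * x $ j * cnj (v $ i))"
    using assms by (simp add: scalar_prod_def mult_mat_vec_def sum_distrib_right row_def)
  also have "\<dots> = (\<Sum>j\<in>{0..<D}. \<Sum>i\<in>{0..<D}. K $$ (i, j) * x $ j * cnj (v $ i))"
    by (rule sum.swap)
  also have "\<dots> = x \<bullet>c (mat_adjoint K *\<^sub>v v)"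
    using assms by (simp add: scalar_prod_def mult_mat_vec_def row_def mat_adjoint_def mat_of_rows_def
        sum_distrib_left mult_ac)
  finally show ?thesis .
qed

text \<open>The expectation in \<open>v\<close> is the expectation of \<open>A\<close> in the vector
  \<open>mat_adjoint K *\<^sub>v v\<close>.\<close>

lemma psd_sandwich:
  assumes K: "K \<in> carrier_mat D D" and A: "psd D A"
  shows "psd D (K * A * mat_adjoint K)"
  unfolding psd_def
proof (intro conjI ballI)
  note K' = mat_adjoint_carrier[OF K] and A' = psd_carrier[OF A]
  show "K * A * mat_adjoint K \<in> carrier_mat D D" using K K' A' by simp
  fix v :: "complex vec" assume v: "v \<in> carrier_vec D"
  let ?w = "mat_adjoint K *\<^sub>v v"
  have w: "?w \<in> carrier_vec D" using K' v by simp
  have "(K * A * mat_adjoint K) *\<^sub>v v = (K * A) *\<^sub>v ?w"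
    using K K' A' v by (intro assoc_mult_mat_vec[where n\<^sub>1 = D and n\<^sub>2 = D and n\<^sub>3 = D]) auto
  also have "\<dots> = K *\<^sub>v (A *\<^sub>v ?w)"
    using K A' w by (rule assoc_mult_mat_vec)
  finally have "((K * A * mat_adjoint K) *\<^sub>v v) \<bullet>c v = (A *\<^sub>v ?w) \<bullet>c ?w"
    using scalar_prod_mat_adjoint[OF K _ v, of "A *\<^sub>v ?w"] A' w by simp
  then show "0 \<le> ((K * A * mat_adjoint K) *\<^sub>v v) \<bullet>c v" using A w by (simp add: psd_def)
qed

text \<open>Positivity is the case \<open>m = 1\<close> of complete positivity: the block matrix
  then has a single block, and the ampliation is \<open>L\<close> itself.\<close>

lemma completely_positive_psd:
  assumes L: "linear_superop D L" and cp: "completely_positive D L" and A: "psd D A"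
  shows "psd D (L A)"
proof -
  have "ampliation 1 D L A = L A"
  proof (intro eq_matI)
    have c: "L A \<in> carrier_mat D D" using linear_superop_carrier[OF L psd_carrier[OF A]] .
    have "mat D D (\<lambda>(a, b). A $$ (a, b)) = A" using psd_carrier[OF A] by (intro eq_matI) auto
    then show "ampliation 1 D L A $$ (i, j) = L A $$ (i, j)"
      if "i < dim_row (L A)" "j < dim_col (L A)" for i j
      using that c by (simp add: ampliation_def)
    show "dim_row (ampliation 1 D L A) = dim_row (L A)" "dim_col (ampliation 1 D L A) = dim_col (L A)"
      using c by (simp_all add: ampliation_def)
  qed
  moreover have "psd (1 * D) (ampliation 1 D L A)"
    using cp A unfolding completely_positive_def by (metis mult_1)
  ultimately show ?thesis by simp
qed

section \<open>Error channel and Poissonian noise\<close>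

lemma linear_superop_error_channel:
  assumes "noise_model D N lam E"
  shows "linear_superop D (error_channel D N lam E)"
  unfolding error_channel_def[abs_def] using assms
  by (intro linear_superop_smult[OF linear_superop_mat_sum[OF linear_superop_smult[OF linear_superop_sandwich]]])
     (auto simp: noise_model_def intro: mat_adjoint_carrier)

lemma psd_error_channel:
  assumes "noise_model D N lam E" "psd D A"
  shows "psd D (error_channel D N lam E A)"
proof -
  have "psd D (complex_of_real (1 / real N) \<cdot>\<^sub>m
     mat_sum D (\<lambda>\<mu>. complex_of_real (lam \<mu>) \<cdot>\<^sub>m (E \<mu> * A * mat_adjoint (E \<mu>))) {1..N})"
    using assms
    by (intro psd_smult psd_mat_sum psd_sandwich) (auto simp: noise_model_def less_imp_le)
  then show ?thesis by (simp add: error_channel_def)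
qed

text \<open>Unitarity turns each halved anticommutator into \<open>A\<close> itself, and the rates
  add up to \<open>N\<close>. What remains is the jump part, which is \<open>N\<close> times the
  error channel.\<close>

lemma noise_lindbladian_poissonian:
  assumes nm: "noise_model D N lam E" and po: "poissonian D N E" and A: "A \<in> carrier_mat D D"
  shows "noise_lindbladian D N lam E A = of_nat N \<cdot>\<^sub>m (error_channel D N lam E A - A)"
proof (intro eq_matI)
  show "dim_row (noise_lindbladian D N lam E A) = dim_row (of_nat N \<cdot>\<^sub>m (error_channel D N lam E A - A))"
    "dim_col (noise_lindbladian D N lam E A) = dim_col (of_nat N \<cdot>\<^sub>m (error_channel D N lam E A - A))"
    using A by (simp_all add: noise_lindbladian_def mat_sum_def)
  fix i j assume "i < dim_row (of_nat N \<cdot>\<^sub>m (error_channel D N lam E A - A))"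
    "j < dim_col (of_nat N \<cdot>\<^sub>m (error_channel D N lam E A - A))"
  then have ij: "i < D" "j < D" using A by auto
  have N: "0 < N" "(\<Sum>\<mu>=1..N. lam \<mu>) = real N" and E: "\<And>\<mu>. \<mu> \<in> {1..N} \<Longrightarrow> E \<mu> \<in> carrier_mat D D"
    using nm by (auto simp: noise_model_def)
  let ?J = "\<lambda>\<mu>. E \<mu> * A * mat_adjoint (E \<mu>)"
  have J: "?J \<mu> \<in> carrier_mat D D" if "\<mu> \<in> {1..N}" for \<mu>
    using E[OF that] mat_adjoint_carrier[OF E[OF that]] A by simp
  have "noise_lindbladian D N lam E A $$ (i, j)
      = (\<Sum>\<mu>=1..N. complex_of_real (lam \<mu>) * ?J \<mu> $$ (i, j) - complex_of_real (lam \<mu>) * A $$ (i, j))"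
    unfolding noise_lindbladian_def mat_sum_def index_mat[OF ij] split
  proof (rule sum.cong[OF refl])
    fix \<mu> assume m: "\<mu> \<in> {1..N}"
    have u: "mat_adjoint (E \<mu>) * E \<mu> = 1\<^sub>m D" using po m by (auto simp: poissonian_def)
    show "(complex_of_real (lam \<mu>) \<cdot>\<^sub>m (?J \<mu> - (1 / 2) \<cdot>\<^sub>m
        (mat_adjoint (E \<mu>) * E \<mu> * A + A * (mat_adjoint (E \<mu>) * E \<mu>)))) $$ (i, j)
      = complex_of_real (lam \<mu>) * ?J \<mu> $$ (i, j) - complex_of_real (lam \<mu>) * A $$ (i, j)"
      unfolding u using J[OF m] A ij by (simp add: algebra_simps)
  qed
  also have "\<dots> = (\<Sum>\<mu>=1..N. complex_of_real (lam \<mu>) * ?J \<mu> $$ (i, j)) - of_nat N * A $$ (i, j)"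
  proof -
    have "(\<Sum>\<mu>=1..N. complex_of_real (lam \<mu>) * A $$ (i, j)) = complex_of_real (\<Sum>\<mu>=1..N. lam \<mu>) * A $$ (i, j)"
      by (simp only: of_real_sum sum_distrib_right)
    then show ?thesis unfolding N(2) by (simp only: sum_subtractf of_real_of_nat_eq)
  qed
  also have "(\<Sum>\<mu>=1..N. complex_of_real (lam \<mu>) * ?J \<mu> $$ (i, j))
      = of_nat N * error_channel D N lam E A $$ (i, j)"
  proof -
    have "(\<Sum>\<mu>=1..N. (complex_of_real (lam \<mu>) \<cdot>\<^sub>m ?J \<mu>) $$ (i, j))
        = (\<Sum>\<mu>=1..N. complex_of_real (lam \<mu>) * ?J \<mu> $$ (i, j))"
    proof (intro sum.cong refl)
      fix \<mu> assume "\<mu> \<in> {1..N}"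
      from carrier_matD[OF J[OF this]] ij
      show "(complex_of_real (lam \<mu>) \<cdot>\<^sub>m ?J \<mu>) $$ (i, j) = complex_of_real (lam \<mu>) * ?J \<mu> $$ (i, j)"
        by (simp del: index_mult_mat)
    qed
    then show ?thesis using N ij by (simp add: error_channel_def mat_sum_def)
  qed
  finally show "noise_lindbladian D N lam E A $$ (i, j)
      = (of_nat N \<cdot>\<^sub>m (error_channel D N lam E A - A)) $$ (i, j)"
    using ij A by (simp add: algebra_simps)
qed

section \<open>Random choice between recovery and error\<close>

text \<open>A single event of the uniformized process: an error with probability \<open>p\<close>, a
  recovery otherwise.\<close>

definition jump_channel ::
    "real \<Rightarrow> (complex mat \<Rightarrow> complex mat) \<Rightarrow> (complex mat \<Rightarrow> complex mat) \<Rightarrow> complex mat \<Rightarrow> complex mat" where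
  "jump_channel p R \<E> A = complex_of_real (1 - p) \<cdot>\<^sub>m R A + complex_of_real p \<cdot>\<^sub>m \<E> A"

lemma linear_superop_jump_channel:
  "linear_superop D R \<Longrightarrow> linear_superop D \<E> \<Longrightarrow> linear_superop D (jump_channel p R \<E>)"
  unfolding jump_channel_def[abs_def] 
  by (rule linear_superop_add[OF linear_superop_smult linear_superop_smult])

text \<open>The total event rate \<Lambda> splits into \<kappa> for recoveries and
  \<open>N \<Delta>\<close> for errors, and these are the shares \<open>1 - p\<close> and
  \<open>p\<close> of \<Lambda>.\<close>

lemma full_lindbladian_jump_channel:
  fixes D N lam E R \<kappa> \<Delta>
  defines "\<Lambda> \<equiv> \<kappa> + real N * \<Delta>"
  assumes nm: "noise_model D N lam E" and po: "poissonian D N E" and R: "linear_superop D R"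
    and pos: "0 < \<Lambda>" and A: "A \<in> carrier_mat D D"
  shows "full_lindbladian D N lam E R \<kappa> \<Delta> A = complex_of_real \<Lambda> \<cdot>\<^sub>m
     (jump_channel (real N * \<Delta> / \<Lambda>) R (error_channel D N lam E) A - A)"
proof (intro eq_matI)
  let ?\<E> = "error_channel D N lam E"
  have RA: "R A \<in> carrier_mat D D" and EA: "?\<E> A \<in> carrier_mat D D"
    using linear_superop_carrier[OF R A]
      linear_superop_carrier[OF linear_superop_error_channel[OF nm] A] by auto
  let ?rhs = "complex_of_real \<Lambda> \<cdot>\<^sub>m (jump_channel (real N * \<Delta> / \<Lambda>) R ?\<E> A - A)"
  show "dim_row (full_lindbladian D N lam E R \<kappa> \<Delta> A) = dim_row ?rhs"
    "dim_col (full_lindbladian D N lam E R \<kappa> \<Delta> A) = dim_col ?rhs"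
    using A RA EA
    by (simp_all add: full_lindbladian_def noise_lindbladian_poissonian[OF nm po A])
  fix i j assume "i < dim_row ?rhs" "j < dim_col ?rhs"
  then have ij: "i < D" "j < D" using A by auto
  have e1: "\<Lambda> * (1 - real N * \<Delta> / \<Lambda>) = \<kappa>" and e2: "\<Lambda> * (real N * \<Delta> / \<Lambda>) = real N * \<Delta>"
    using pos by (auto simp: \<Lambda>_def field_simps)
  have "?rhs $$ (i, j) = complex_of_real (\<Lambda> * (1 - real N * \<Delta> / \<Lambda>)) * R A $$ (i, j)
      + complex_of_real (\<Lambda> * (real N * \<Delta> / \<Lambda>)) * ?\<E> A $$ (i, j) - complex_of_real \<Lambda> * A $$ (i, j)"
    using A RA EA ij unfolding of_real_mult by (simp add: jump_channel_def algebra_simps)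
  also have "\<dots> = full_lindbladian D N lam E R \<kappa> \<Delta> A $$ (i, j)"
    unfolding e1 e2 using A RA EA ij
    by (simp add: full_lindbladian_def noise_lindbladian_poissonian[OF nm po A]
        recovery_lindbladian_def \<Lambda>_def algebra_simps)
  finally show "full_lindbladian D N lam E R \<kappa> \<Delta> A $$ (i, j) = ?rhs $$ (i, j)" ..
qed

section \<open>Pure states and fidelity\<close>

lemma ketbra_mult_vec:
  assumes "v \<in> carrier_vec (dim_vec \<psi>)"
  shows "ketbra \<psi> *\<^sub>v v = (v \<bullet>c \<psi>) \<cdot>\<^sub>v \<psi>"
  using assms
  by (intro eq_vecI)
     (auto simp: ketbra_def mult_mat_vec_def row_def scalar_prod_def sum_distrib_left mult_ac)

text \<open>The expectation in \<open>v\<close> is the squared modulus of the overlap of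
  \<open>v\<close> with \<psi>.\<close>

lemma psd_ketbra:
  assumes "\<psi> \<in> carrier_vec D"
  shows "psd D (ketbra \<psi>)"
  unfolding psd_def
proof (intro conjI ballI)
  show "ketbra \<psi> \<in> carrier_mat D D" using assms by (auto simp: ketbra_def)
  fix v :: "complex vec" assume v: "v \<in> carrier_vec D"
  have "\<psi> \<bullet>c v = cnj (v \<bullet>c \<psi>)"
    using assms v by (simp add: scalar_prod_def mult.commute)
  then have "(ketbra \<psi> *\<^sub>v v) \<bullet>c v = (v \<bullet>c \<psi>) * cnj (v \<bullet>c \<psi>)"
    using assms v by (simp add: ketbra_mult_vec)
  then show "0 \<le> (ketbra \<psi> *\<^sub>v v) \<bullet>c v"
    by (simp add: complex_mult_cnj less_eq_complex_def)
qed

text \<open>Turns the trace form of the fidelity in \<open>logical_error\<close> into an expectation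
  value, which \<open>linear_form_expectation\<close> treats as a linear functional.\<close>

lemma mat_trace_ketbra_mult:
  assumes "\<psi> \<in> carrier_vec D" "A \<in> carrier_mat D D"
  shows "mat_trace (ketbra \<psi> * A) = (A *\<^sub>v \<psi>) \<bullet>c \<psi>"
proof -
  have "mat_trace (ketbra \<psi> * A) = (\<Sum>i\<in>{0..<D}. \<Sum>j\<in>{0..<D}. A $$ (j, i) * \<psi> $ i * cnj (\<psi> $ j))"
    using assms
    by (auto simp: mat_trace_def ketbra_def scalar_prod_def lessThan_atLeast0 mult_ac intro!: sum.cong)
  also have "\<dots> = (\<Sum>j\<in>{0..<D}. \<Sum>i\<in>{0..<D}. A $$ (j, i) * \<psi> $ i * cnj (\<psi> $ j))"
    by (rule sum.swap)
  also have "\<dots> = (A *\<^sub>v \<psi>) \<bullet>c \<psi>"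
    using assms by (simp add: scalar_prod_def mult_mat_vec_def row_def sum_distrib_right)
  finally show ?thesis .
qed

lemma density_op_ketbra:
  assumes "\<psi> \<in> carrier_vec D" "\<psi> \<bullet>c \<psi> = 1"
  shows "density_op D (ketbra \<psi>)"
proof -
  have "mat_trace (ketbra \<psi>) = \<psi> \<bullet>c \<psi>"
    using assms by (simp add: mat_trace_def ketbra_def scalar_prod_def lessThan_atLeast0)
  then show ?thesis using assms psd_ketbra by (simp add: density_op_def)
qed

section \<open>Recursion for the fidelity\<close>

text \<open>
  The values \<open>u k j\<close> stand for the fidelity after \<open>j\<close> errors followed by \<open>k\<close> steps that are
  recoveries with probability \<open>1 - p\<close> and errors with probability \<open>p\<close>.
\<close>

lemma fidelity_recursion:
  fixes u :: "nat \<Rightarrow> nat \<Rightarrow> real" and p \<xi> :: real and H :: nat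
  defines "a \<equiv> (1 - \<xi>) * (1 - p ^ Suc H)"
  assumes p: "0 \<le> p" "p \<le> 1" and \<xi>: "0 \<le> \<xi>" "\<xi> \<le> 1"
    and u0: "u 0 0 = 1" and uj: "\<And>j. j \<le> H \<Longrightarrow> 1 - \<xi> \<le> u 0 j" and pos: "\<And>k j. 0 \<le> u k j"
    and step: "\<And>k j. j \<le> H \<Longrightarrow> (1 - p) * ((1 - \<xi>) * u k 0) + p * u k (Suc j) \<le> u (Suc k) j"
  shows "a ^ k \<le> u k 0"
proof -
  have a: "0 \<le> a" "a \<le> 1"
    using p \<xi> by (auto simp: a_def power_le_one mult_le_one simp del: power_Suc)
  have pp: "0 \<le> 1 - p ^ m" "1 - p ^ m \<le> 1" for m using p by (auto simp: power_le_one)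
  \<comment> \<open>The induction carries a bound for every tolerable \<open>j\<close>. Unless the
    next \<open>Suc H - j\<close> events are all errors, a recovery comes in time; it costs the
    factor \<open>1 - \<xi>\<close> and resets the error count with at most \<open>k - 1\<close>
    events left, hence the exponent. For \<open>k = 0\<close> truncated subtraction makes that power
    1, and the first conjunct rests on \<open>u 0 0 = 1\<close>.\<close>
  have "a ^ k \<le> u k 0 \<and> (\<forall>j\<le>H. (1 - \<xi>) * (1 - p ^ (Suc H - j)) * a ^ (k - 1) \<le> u k j)"
  proof (induction k)
    case 0
    have "(1 - \<xi>) * (1 - p ^ m) \<le> 1 - \<xi>" for m
      using pp \<xi> by (simp add: mult_left_le)
    then show ?case using u0 uj by (auto intro: order.trans simp del: power_Suc)
  next
    case (Suc k)
    \<comment> \<open>For \<open>j = H\<close> the next error exceeds the tolerable weight: the left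
      side vanishes and nonnegativity of \<open>u\<close> suffices. Otherwise the induction
      hypothesis applies, with its power of \<open>a\<close> lowered from exponent
      \<open>k - 1\<close> to \<open>k\<close>.\<close>
    have next_err: "(1 - \<xi>) * (1 - p ^ (H - j)) * a ^ k \<le> u k (Suc j)" if "j \<le> H" for j
    proof (cases "j = H")
      case True
      then show ?thesis using pos by simp
    next
      case False
      have "a ^ k \<le> a ^ (k - 1)" using a by (intro power_decreasing) auto
      then have "(1 - \<xi>) * (1 - p ^ (H - j)) * a ^ k \<le> (1 - \<xi>) * (1 - p ^ (H - j)) * a ^ (k - 1)"
        using pp \<xi> by (intro mult_left_mono) auto
      also have "\<dots> \<le> u k (Suc j)" using Suc.IH False that by (metis Suc_leI diff_Suc_Suc le_neq_implies_less)
      finally show ?thesis .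
    qed
    have main: "(1 - \<xi>) * (1 - p ^ (Suc H - j)) * a ^ k \<le> u (Suc k) j" if j: "j \<le> H" for j
    proof -
      \<comment> \<open>Conditioning on the first event:
        \<open>1 - p ^ (m + 1) = (1 - p) + p * (1 - p ^ m)\<close> with
        \<open>m = H - j\<close>.\<close>
      have "(1 - \<xi>) * (1 - p ^ (Suc H - j)) * a ^ k
          = (1 - p) * ((1 - \<xi>) * a ^ k) + p * ((1 - \<xi>) * (1 - p ^ (H - j)) * a ^ k)"
        using j by (simp add: Suc_diff_le algebra_simps)
      also have "\<dots> \<le> (1 - p) * ((1 - \<xi>) * u k 0) + p * u k (Suc j)"
        using p \<xi> Suc.IH next_err[OF j] by (intro add_mono mult_left_mono) auto
      also have "\<dots> \<le> u (Suc k) j" by (rule step[OF j])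
      finally show ?thesis .
    qed
    have "a ^ Suc k \<le> u (Suc k) 0" using main[of 0] by (simp add: a_def)
    then show ?case using main by simp
  qed
  then show ?thesis by simp
qed

section \<open>Fidelity under the full dynamics\<close>

lemma linear_superop_cong:
  assumes "\<And>A. A \<in> carrier_mat D D \<Longrightarrow> L A = L' A" and "linear_superop D L'"
  shows "linear_superop D L"
  using assms by (simp add: linear_superop_def)

lemma psd_jump_channel_funpow:
  assumes p: "0 \<le> p" "p \<le> 1"
    and R: "\<And>A. psd D A \<Longrightarrow> psd D (R A)" and \<E>: "\<And>A. psd D A \<Longrightarrow> psd D (\<E> A)" and A: "psd D A"
  shows "psd D ((jump_channel p R \<E> ^^ k) A)"
proof (induction k)
  case (Suc k)
  then show ?case using p R \<E> by (simp add: jump_channel_def psd_add psd_smult del: of_real_diff)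
qed (simp add: A)

lemma psd_expectation:
  assumes "psd D A" "v \<in> carrier_vec D"
  shows "0 \<le> Re ((A *\<^sub>v v) \<bullet>c v)"
  using assms by (simp add: psd_def less_eq_complex_def)

lemma ketbra_expectation:
  assumes "\<psi> \<bullet>c \<psi> = 1"
  shows "(ketbra \<psi> *\<^sub>v \<psi>) \<bullet>c \<psi> = 1"
  using assms by (simp add: ketbra_mult_vec)

text \<open>An instance of \<open>fidelity_recursion\<close>: \<open>u k j\<close> is the fidelity
  after \<open>j\<close> errors, then \<open>k\<close> random events, then a final recovery.\<close>

lemma recovered_fidelity_ge_power:
  fixes p \<xi> :: real and H :: nat
  assumes R: "linear_superop D R" "\<And>A. psd D A \<Longrightarrow> psd D (R A)"
    and \<E>: "linear_superop D \<E>" "\<And>A. psd D A \<Longrightarrow> psd D (\<E> A)"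
    and \<psi>: "\<psi> \<in> carrier_vec D" "\<psi> \<bullet>c \<psi> = 1" and R\<psi>: "R (ketbra \<psi>) = ketbra \<psi>"
    and p: "0 \<le> p" "p \<le> 1" and \<xi>: "0 \<le> \<xi>" "\<xi> \<le> 1"
    and tol: "\<And>j. j \<le> H \<Longrightarrow>
      psd D (R ((\<E> ^^ j) (ketbra \<psi>)) - complex_of_real (1 - \<xi>) \<cdot>\<^sub>m ketbra \<psi>)"
  shows "((1 - \<xi>) * (1 - p ^ Suc H)) ^ k
    \<le> Re ((R ((jump_channel p R \<E> ^^ k) (ketbra \<psi>)) *\<^sub>v \<psi>) \<bullet>c \<psi>)"
proof -
  let ?P = "ketbra \<psi>" and ?M = "jump_channel p R \<E>"
  define F where "F = (\<lambda>A. (R A *\<^sub>v \<psi>) \<bullet>c \<psi>)"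
  have F: "linear_form D F"
    unfolding F_def by (rule linear_form_compose[OF linear_form_expectation[OF \<psi>(1)] R(1)])
  have FM: "linear_form D (\<lambda>A. F ((?M ^^ k) A))" for k
    by (rule linear_form_compose[OF F linear_superop_funpow[OF linear_superop_jump_channel[OF R(1) \<E>(1)]]])
  have FMpos: "0 \<le> Re (F ((?M ^^ k) A))" if "psd D A" for k A
  proof -
    have "psd D ((?M ^^ k) A)"
      by (rule psd_jump_channel_funpow[OF p _ _ that]) (erule R(2) \<E>(2))+
    then show ?thesis unfolding F_def by (rule psd_expectation[OF R(2) \<psi>(1)])
  qed
  have P: "psd D ?P" by (rule psd_ketbra[OF \<psi>(1)])
  have EP: "psd D ((\<E> ^^ j) ?P)" for j by (induction j) (auto simp: P \<E>(2))
  have unit: "(?P *\<^sub>v \<psi>) \<bullet>c \<psi> = 1" by (rule ketbra_expectation[OF \<psi>(2)])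
  define u where "u = (\<lambda>k j. Re (F ((?M ^^ k) ((\<E> ^^ j) ?P))))"
  have "((1 - \<xi>) * (1 - p ^ Suc H)) ^ k \<le> u k 0"
  proof (rule fidelity_recursion[OF p \<xi>])
    show "u 0 0 = 1" by (simp add: u_def F_def R\<psi> unit)
    show "0 \<le> u k j" for k j unfolding u_def by (rule FMpos[OF EP])
    fix j assume j: "j \<le> H"
    let ?X = "(\<E> ^^ j) ?P"
    have c: "?X \<in> carrier_mat D D" "R ?X \<in> carrier_mat D D" "\<E> ?X \<in> carrier_mat D D" "?P \<in> carrier_mat D D"
      using psd_carrier[OF EP] psd_carrier[OF R(2)[OF EP]] psd_carrier[OF \<E>(2)[OF EP]] psd_carrier[OF P]
      by auto
    \<comment> \<open>Tolerance is an operator inequality, so it survives every positive linear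
      functional \<open>G\<close>. It is used for the expectation in \<psi> and for the fidelity
      after \<open>k\<close> further events.\<close>
    have form_ge: "(1 - \<xi>) * Re (G ?P) \<le> Re (G (R ?X))"
      if G: "linear_form D G" and Gpos: "\<And>A. psd D A \<Longrightarrow> 0 \<le> Re (G A)" for G
    proof -
      have "G (R ?X - complex_of_real (1 - \<xi>) \<cdot>\<^sub>m ?P) = G (R ?X) - complex_of_real (1 - \<xi>) * G ?P"
        using G c by (simp add: linear_form_diff[OF G] linear_form_def del: of_real_diff)
      then show ?thesis using Gpos[OF tol[OF j]] by (simp del: of_real_diff)
    qed
    show "1 - \<xi> \<le> u 0 j"
      using form_ge[OF linear_form_expectation[OF \<psi>(1)] psd_expectation[OF _ \<psi>(1)]] unit
      by (simp add: u_def F_def)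
    fix k
    let ?G = "\<lambda>A. F ((?M ^^ k) A)"
    \<comment> \<open>The event that happens first, the innermost one, is split off: a recovery of
      \<open>?X\<close>, or one more error on it.\<close>
    have "F ((?M ^^ Suc k) ?X) = complex_of_real (1 - p) * ?G (R ?X) + complex_of_real p * ?G (\<E> ?X)"
      using FM[of k] c unfolding linear_form_def funpow_Suc_right comp_def
      by (simp add: jump_channel_def[of p R \<E> ?X] del: of_real_diff)
    then have "u (Suc k) j = (1 - p) * Re (?G (R ?X)) + p * u k (Suc j)"
      by (simp add: u_def del: of_real_diff funpow.simps(2)) simp
    moreover have "(1 - \<xi>) * u k 0 \<le> Re (?G (R ?X))"
      using form_ge[OF FM FMpos] by (simp add: u_def)
    ultimately show "(1 - p) * ((1 - \<xi>) * u k 0) + p * u k (Suc j) \<le> u (Suc k) j"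
      using p by (simp add: mult_left_mono)
  qed
  then show ?thesis by (simp add: u_def F_def)
qed

text \<open>The number of events is Poisson distributed with mean \<open>\<Lambda> * t\<close>. The
  Poisson weights are nonnegative, so the bounds may be averaged term by term, and averaging
  \<open>a ^ k\<close> evaluates the Poisson generating function at \<open>a\<close>.\<close>

lemma exp_le_recovered_fidelity:
  fixes D N lam E R \<kappa> \<Delta>
  defines "\<Lambda> \<equiv> \<kappa> + real N * \<Delta>"
  defines "M \<equiv> jump_channel (real N * \<Delta> / \<Lambda>) R (error_channel D N lam E)"
  assumes nm: "noise_model D N lam E" and po: "poissonian D N E" and R: "linear_superop D R"
    and pos: "0 < \<Lambda>" and t: "0 \<le> t" and \<psi>: "\<psi> \<in> carrier_vec D"
    and ge: "\<And>k. a ^ k \<le> Re ((R ((M ^^ k) (ketbra \<psi>)) *\<^sub>v \<psi>) \<bullet>c \<psi>)"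
  shows "exp (- ((1 - a) * \<Lambda> * t))
    \<le> Re (mat_trace (ketbra \<psi> * R (superop_exp D (full_lindbladian D N lam E R \<kappa> \<Delta>) t (ketbra \<psi>))))"
proof -
  let ?L = "full_lindbladian D N lam E R \<kappa> \<Delta>" and ?P = "ketbra \<psi>"
  define F where "F = (\<lambda>A. (R A *\<^sub>v \<psi>) \<bullet>c \<psi>)"
  have F: "linear_form D F"
    unfolding F_def by (rule linear_form_compose[OF linear_form_expectation[OF \<psi>] R])
  have P: "?P \<in> carrier_mat D D" by (rule psd_carrier[OF psd_ketbra[OF \<psi>]])
  have M: "linear_superop D M"
    unfolding M_def by (rule linear_superop_jump_channel[OF R linear_superop_error_channel[OF nm]])
  have LM: "?L A = complex_of_real \<Lambda> \<cdot>\<^sub>m (M A - A)" if "A \<in> carrier_mat D D" for A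
    using full_lindbladian_jump_channel[OF nm po R _ that] pos unfolding M_def \<Lambda>_def by blast
  \<comment> \<open>Linearity of the Lindbladian is read off from its form
    \<open>\<Lambda> (M - id)\<close>, with the subtraction written as adding a negative multiple to
    fit the closure lemmas.\<close>
  have "linear_superop D (\<lambda>A. A)" by (simp add: linear_superop_def)
  from linear_superop_smult[OF linear_superop_add[OF M linear_superop_smult[OF this]]]
  have lin: "linear_superop D (\<lambda>A. complex_of_real \<Lambda> \<cdot>\<^sub>m (M A + (-1) \<cdot>\<^sub>m A))" .
  have "?L A = complex_of_real \<Lambda> \<cdot>\<^sub>m (M A + (-1) \<cdot>\<^sub>m A)" if A: "A \<in> carrier_mat D D" for A
    unfolding LM[OF A] using A linear_superop_carrier[OF M A] by (intro eq_matI) auto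
  then have L: "linear_superop D ?L" using lin by (rule linear_superop_cong)
  have "(\<lambda>m. complex_of_real ((\<Lambda> * t) ^ m / fact m) * F ((M ^^ m) ?P))
      sums (F (superop_exp D ?L t ?P) * complex_of_real (exp (\<Lambda> * t)))"
    by (rule superop_exp_poisson[OF F L M _ P]) (rule LM)
  note series = sums_Re[OF this]
  have re: "Re (complex_of_real x * z) = x * Re z" "Re (z * complex_of_real x) = Re z * x" for x z
    by simp_all
  from series
  have fid: "(\<lambda>m. (\<Lambda> * t) ^ m / fact m * Re (F ((M ^^ m) ?P)))
      sums (Re (F (superop_exp D ?L t ?P)) * exp (\<Lambda> * t))"
    by (simp only: re)
  have pow: "(\<lambda>m. (\<Lambda> * t) ^ m / fact m * a ^ m) sums exp (\<Lambda> * t * a)"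
    using exp_converges[of "\<Lambda> * t * a"] by (simp add: power_mult_distrib divide_inverse mult_ac)
  have "(\<Lambda> * t) ^ m / fact m * a ^ m \<le> (\<Lambda> * t) ^ m / fact m * Re (F ((M ^^ m) ?P))" for m
    using ge[of m] pos t by (intro mult_left_mono) (auto simp: F_def)
  then have "exp (\<Lambda> * t * a) \<le> Re (F (superop_exp D ?L t ?P)) * exp (\<Lambda> * t)"
    using pow fid by (rule sums_le)
  moreover have "exp (- ((1 - a) * \<Lambda> * t)) = exp (\<Lambda> * t * a) / exp (\<Lambda> * t)"
    unfolding exp_diff[symmetric] by (simp add: algebra_simps)
  moreover have "mat_trace (ketbra \<psi> * R (superop_exp D ?L t ?P)) = F (superop_exp D ?L t ?P)"
    unfolding F_def
    by (rule mat_trace_ketbra_mult[OF \<psi> linear_superop_carrier[OF R superop_exp_carrier]])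
  ultimately show ?thesis by (simp add: divide_le_eq)
qed

section \<open>Codespaces and their recovery\<close>

lemma codespace_carrier: "is_codespace n C \<Longrightarrow> \<psi> \<in> C \<Longrightarrow> \<psi> \<in> carrier_vec (2 ^ n)"
  by (auto simp: VectorSpace.subspace_def submodule_def module_vec_simps)

lemma codespace_smult:
  assumes "is_codespace n C" "\<psi> \<in> C"
  shows "c \<cdot>\<^sub>v \<psi> \<in> C"
  using assms by (auto simp: VectorSpace.subspace_def submodule_def module_vec_simps class_ring_simps)

text \<open>On the zero space every operator is detectable, so a code with a distance has a nonzero
  vector, which can be normalized. This makes the infimum in \<open>logical_error\<close> range over
  a nonempty set.\<close>

lemma has_code_distance_unit_vector:
  assumes C: "is_codespace n C" and d: "has_code_distance n C d"
  shows "\<exists>\<psi>\<in>C. \<psi> \<bullet>c \<psi> = 1"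
proof -
  obtain p where p: "\<not> detectable C (pauli_string n p)"
    using d by (auto simp: has_code_distance_def)
  have "\<exists>\<phi>\<in>C. \<phi> \<noteq> 0\<^sub>v (2 ^ n)"
  proof (rule ccontr)
    assume "\<not> ?thesis"
    then have "\<psi> = 0\<^sub>v (2 ^ n)" if "\<psi> \<in> C" for \<psi> using that by blast
    moreover have "(pauli_string n p *\<^sub>v 0\<^sub>v (2 ^ n)) \<bullet>c 0\<^sub>v (2 ^ n) = 0"
    proof -
      have "pauli_string n p \<in> carrier_mat (2 ^ n) (2 ^ n)" by (simp add: pauli_string_def)
      then have "pauli_string n p *\<^sub>v 0\<^sub>v (2 ^ n) \<in> carrier_vec (2 ^ n)"
        by (rule mult_mat_vec_carrier) (rule zero_carrier_vec)
      then show ?thesis unfolding conjugate_zero_vec by (rule scalar_prod_right_zero)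
    qed
    ultimately have "(pauli_string n p *\<^sub>v \<psi>) \<bullet>c \<phi> = 0 * (\<psi> \<bullet>c \<phi>)" if "\<phi> \<in> C" "\<psi> \<in> C" for \<phi> \<psi>
      using that by (metis mult_zero_left)
    then have "detectable C (pauli_string n p)" unfolding detectable_def by blast
    with p show False by contradiction
  qed
  then obtain \<phi> where \<phi>: "\<phi> \<in> C" "\<phi> \<noteq> 0\<^sub>v (2 ^ n)" by blast
  have c: "\<phi> \<in> carrier_vec (2 ^ n)" by (rule codespace_carrier[OF C \<phi>(1)])
  define s where "s = Re (\<phi> \<bullet>c \<phi>)"
  have s: "\<phi> \<bullet>c \<phi> = complex_of_real s" "0 < s"
    using conjugate_square_greater_0_vec[OF c] \<phi>(2)
    by (auto simp: s_def less_complex_def complex_eq_iff)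
  define r where "r = 1 / sqrt s"
  have "(complex_of_real r \<cdot>\<^sub>v \<phi>) \<bullet>c (complex_of_real r \<cdot>\<^sub>v \<phi>) = complex_of_real (r * r * s)"
    using c s(1) by (simp add: conjugate_smult_vec)
  also have "r * r * s = 1" using s(2) by (simp add: r_def field_simps)
  finally have "(complex_of_real r \<cdot>\<^sub>v \<phi>) \<bullet>c (complex_of_real r \<cdot>\<^sub>v \<phi>) = 1" by simp
  then show ?thesis using codespace_smult[OF C \<phi>(1)] by blast
qed

text \<open>The range of the projector consists of multiples of \<psi>, so it is a density operator
  supported on the code and is fixed by recovery.\<close>

lemma recovery_map_ketbra:
  assumes C: "is_codespace n C" and R: "recovery_map (2 ^ n) C R"
    and \<psi>: "\<psi> \<in> C" "\<psi> \<bullet>c \<psi> = 1"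
  shows "R (ketbra \<psi>) = ketbra \<psi>"
proof -
  have c: "\<psi> \<in> carrier_vec (2 ^ n)" by (rule codespace_carrier[OF C \<psi>(1)])
  have "supported_on (2 ^ n) C (ketbra \<psi>)"
    using c codespace_smult[OF C \<psi>(1)] by (simp add: supported_on_def ketbra_mult_vec)
  then show ?thesis using R density_op_ketbra[OF c \<psi>(2)] by (simp add: recovery_map_def)
qed

section \<open>The bound for a single code\<close>

lemma logical_error_le:
  fixes \<kappa> \<Delta> t \<xi> :: real and h :: int
  assumes C: "is_codespace n C" and d: "has_code_distance n C d"
    and nm: "noise_model (2 ^ n) N lam E" and po: "poissonian (2 ^ n) N E"
    and R: "recovery_map (2 ^ n) C R"
    and \<xi>: "0 \<le> \<xi>" "\<xi> \<le> 1"
    and tol: "\<And>\<psi> k. \<psi> \<in> C \<Longrightarrow> \<psi> \<bullet>c \<psi> = 1 \<Longrightarrow> int k \<le> h \<Longrightarrow>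
      psd (2 ^ n) (R ((error_channel (2 ^ n) N lam E ^^ k) (ketbra \<psi>)) - complex_of_real (1 - \<xi>) \<cdot>\<^sub>m ketbra \<psi>)"
    and \<kappa>: "0 < \<kappa>" and \<Delta>: "0 < \<Delta>" and t: "0 \<le> t"
  shows "logical_error (2 ^ n) C R (full_lindbladian (2 ^ n) N lam E R \<kappa> \<Delta>) t
       \<le> 1 - exp (- ((1 - \<xi>) * (real N * \<Delta>) * ((real N * \<Delta>) / (\<kappa> + real N * \<Delta>)) powi h * t)
                  - \<xi> * (\<kappa> + real N * \<Delta>) * t)" (is "_ \<le> 1 - ?B")
proof -
  let ?D = "2 ^ n :: nat" and ?\<E> = "error_channel (2 ^ n) N lam E"
  define \<Lambda> where "\<Lambda> = \<kappa> + real N * \<Delta>"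
  define p where "p = real N * \<Delta> / \<Lambda>"
  have N: "0 < N" using nm by (simp add: noise_model_def)
  have \<Lambda>: "0 < \<Lambda>" using \<kappa> \<Delta> by (simp add: \<Lambda>_def add_pos_nonneg)
  have p: "0 < p" "p \<le> 1" and p\<Lambda>: "real N * \<Delta> = p * \<Lambda>"
    using N \<kappa> \<Delta> \<Lambda> by (auto simp: p_def \<Lambda>_def)
  have Rl: "linear_superop ?D R" and Rp: "\<And>A. psd ?D A \<Longrightarrow> psd ?D (R A)"
    using R completely_positive_psd by (auto simp: recovery_map_def cptp_def)
  note \<E>l = linear_superop_error_channel[OF nm] and \<E>p = psd_error_channel[OF nm]
  have "?B \<le> Re (mat_trace (ketbra \<psi> * R (superop_exp ?D (full_lindbladian ?D N lam E R \<kappa> \<Delta>) t (ketbra \<psi>))))"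
    if \<psi>: "\<psi> \<in> C" "\<psi> \<bullet>c \<psi> = 1" for \<psi>
  proof -
    have c: "\<psi> \<in> carrier_vec ?D" by (rule codespace_carrier[OF C \<psi>(1)])
    have R\<psi>: "R (ketbra \<psi>) = ketbra \<psi>" by (rule recovery_map_ketbra[OF C R \<psi>])
    have fid: "exp (- ((1 - a) * \<Lambda> * t))
      \<le> Re (mat_trace (ketbra \<psi> * R (superop_exp ?D (full_lindbladian ?D N lam E R \<kappa> \<Delta>) t (ketbra \<psi>))))"
      if "\<And>k. a ^ k \<le> Re ((R ((jump_channel p R ?\<E> ^^ k) (ketbra \<psi>)) *\<^sub>v \<psi>) \<bullet>c \<psi>)" for a
      using exp_le_recovered_fidelity[OF nm po Rl _ t c, of \<kappa> \<Delta> a] that \<Lambda>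
      unfolding p_def \<Lambda>_def by blast
    show ?thesis
    proof (cases "0 \<le> h")
      case True
      define H where "H = nat h"
      have h: "h = int H" using True by (simp add: H_def)
      \<comment> \<open>With \<open>a = (1 - \<xi>) * (1 - p ^ Suc H)\<close> one has
        \<open>1 - a = \<xi> + (1 - \<xi>) * p ^ Suc H\<close>; one factor \<open>p\<close> combines
        with \<Lambda> to the error rate \<open>N \<Delta>\<close>.\<close>
      have "exp (- ((1 - (1 - \<xi>) * (1 - p ^ Suc H)) * \<Lambda> * t)) = ?B"
        unfolding h power_int_of_nat \<Lambda>_def[symmetric]
        unfolding p_def[symmetric] unfolding p\<Lambda>
        by (simp add: algebra_simps)
      moreover have "exp (- ((1 - (1 - \<xi>) * (1 - p ^ Suc H)) * \<Lambda> * t))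
        \<le> Re (mat_trace (ketbra \<psi> * R (superop_exp ?D (full_lindbladian ?D N lam E R \<kappa> \<Delta>) t (ketbra \<psi>))))"
        using p tol[OF \<psi>]
        by (intro fid recovered_fidelity_ge_power[OF Rl Rp \<E>l \<E>p c \<psi>(2) R\<psi> _ _ \<xi>]) (auto simp: h)
      ultimately show ?thesis by simp
    next
      case False
      \<comment> \<open>For negative \<open>h\<close> the constant is \<open>a = 0\<close>. As
        \<open>0 ^ 0 = 1\<close>, the bound keeps exactly the contribution of no event, where the
        state is recovered perfectly.\<close>
      have "(0::real) ^ k \<le> Re ((R ((jump_channel p R ?\<E> ^^ k) (ketbra \<psi>)) *\<^sub>v \<psi>) \<bullet>c \<psi>)" for k
      proof (cases k)
        case 0
        then show ?thesis by (simp add: R\<psi> ketbra_expectation[OF \<psi>(2)])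
      next
        case (Suc m)
        have "0 \<le> Re ((R ((jump_channel p R ?\<E> ^^ k) (ketbra \<psi>)) *\<^sub>v \<psi>) \<bullet>c \<psi>)"
        proof -
          have "psd ?D ((jump_channel p R ?\<E> ^^ k) (ketbra \<psi>))"
            by (rule psd_jump_channel_funpow[OF _ p(2) _ _ psd_ketbra[OF c]])
               (use p Rp \<E>p in auto)
          then show ?thesis by (rule psd_expectation[OF Rp c])
        qed
        then show ?thesis using Suc by simp
      qed
      note fid[OF this]
      \<comment> \<open>Since \<open>h + 1 \<le> 0\<close> and \<open>0 < p \<le> 1\<close>, the
        power \<open>p powi (h + 1)\<close> is at least 1, so the claimed exponent is at most
        \<open>- \<Lambda> * t\<close>.\<close>
      moreover have "?B \<le> exp (- ((1 - 0) * \<Lambda> * t))"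
      proof -
        define m where "m = nat (- h - 1)"
        have m: "h + 1 = - int m" using False by (simp add: m_def)
        have "1 \<le> p powi (h + 1)"
          unfolding m power_int_minus power_int_of_nat using p by (simp add: one_le_inverse power_le_one)
        then have q: "1 \<le> p * p powi h" using p by (simp add: power_int_add mult.commute)
        have "(1 - \<xi>) * (\<Lambda> * t) * 1 \<le> (1 - \<xi>) * (\<Lambda> * t) * (p * p powi h)"
          using q \<xi> \<Lambda> t by (intro mult_left_mono) auto
        then show ?thesis
          unfolding \<Lambda>_def[symmetric] unfolding p_def[symmetric] unfolding p\<Lambda> by (simp add: algebra_simps)
      qed
      ultimately show ?thesis by linarith
    qed
  qed
  then have "?B \<le> (INF \<psi>\<in>{\<psi>\<in>C. \<psi> \<bullet>c \<psi> = 1}.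
      Re (mat_trace (ketbra \<psi> * R (superop_exp ?D (full_lindbladian ?D N lam E R \<kappa> \<Delta>) t (ketbra \<psi>)))))"
    using has_code_distance_unit_vector[OF C d] by (intro cINF_greatest) auto
  then show ?thesis by (simp add: logical_error_def)
qed

section \<open>From single codes to a code family\<close>

theorem theorem2:
  fixes I :: "nat set"
    and C :: "nat \<Rightarrow> complex vec set"
    and d N :: "nat \<Rightarrow> nat"
    and lam :: "nat \<Rightarrow> nat \<Rightarrow> real"
    and E :: "nat \<Rightarrow> nat \<Rightarrow> complex mat"
    and R :: "nat \<Rightarrow> complex mat \<Rightarrow> complex mat"
    and h :: "nat \<Rightarrow> int"
  assumes "infinite I"
    and "\<And>n. n \<in> I \<Longrightarrow> is_codespace n (C n)"
    and "\<And>n. n \<in> I \<Longrightarrow> has_code_distance n (C n) (d n)"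
    and "\<And>n. n \<in> I \<Longrightarrow> noise_model (2 ^ n) (N n) (lam n) (E n)"
    and "\<And>n. n \<in> I \<Longrightarrow> poissonian (2 ^ n) (N n) (E n)"
    and "\<And>n. n \<in> I \<Longrightarrow> recovery_map (2 ^ n) (C n) (R n)"
    and "tolerable_error_weight I d C (\<lambda>n. error_channel (2 ^ n) (N n) (lam n) (E n)) R h"
  shows "\<exists>\<xi>. exp_small_in I d \<xi> \<and>
    (\<forall>n\<in>I. \<forall>\<kappa>>0. \<forall>\<Delta>>0. \<forall>t\<ge>0.
       logical_error (2 ^ n) (C n) (R n)
         (full_lindbladian (2 ^ n) (N n) (lam n) (E n) (R n) \<kappa> \<Delta>) t
       \<le> 1 - exp (- ((1 - \<xi> n) * (real (N n) * \<Delta>)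
                       * ((real (N n) * \<Delta>) / (\<kappa> + real (N n) * \<Delta>)) powi h n * t)
                  - \<xi> n * (\<kappa> + real (N n) * \<Delta>) * t))"
proof -
  obtain \<xi>\<^sub>0 where small: "exp_small_in I d \<xi>\<^sub>0" and tol:
    "\<And>n \<psi> k. n \<in> I \<Longrightarrow> \<psi> \<in> C n \<Longrightarrow> \<psi> \<bullet>c \<psi> = 1 \<Longrightarrow> int k \<le> h n \<Longrightarrow>
      psd (2 ^ n) (R n ((error_channel (2 ^ n) (N n) (lam n) (E n) ^^ k) (ketbra \<psi>))
                       - complex_of_real (1 - \<xi>\<^sub>0 n) \<cdot>\<^sub>m ketbra \<psi>)"
    using assms(7) unfolding tolerable_error_weight_def by blast
  \<comment> \<open>Capping at 1 keeps \<open>1 - \<xi> n\<close> nonnegative, as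
    \<open>logical_error_le\<close> requires, and can only improve exponential smallness.\<close>
  define \<xi> where "\<xi> = (\<lambda>n. min (\<xi>\<^sub>0 n) 1)"
  have "exp_small_in I d \<xi>"
    using small unfolding exp_small_in_def \<xi>_def by (auto simp: min_le_iff_disj)
  moreover have "logical_error (2 ^ n) (C n) (R n)
         (full_lindbladian (2 ^ n) (N n) (lam n) (E n) (R n) \<kappa> \<Delta>) t
       \<le> 1 - exp (- ((1 - \<xi> n) * (real (N n) * \<Delta>)
                       * ((real (N n) * \<Delta>) / (\<kappa> + real (N n) * \<Delta>)) powi h n * t)
                  - \<xi> n * (\<kappa> + real (N n) * \<Delta>) * t)"
    if n: "n \<in> I" and pos: "0 < \<kappa>" "0 < \<Delta>" "0 \<le> t" for n \<kappa> \<Delta> t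
  proof (rule logical_error_le[OF assms(2-6)[OF n] _ _ _ pos])
    show "0 \<le> \<xi> n" "\<xi> n \<le> 1" using small n by (auto simp: \<xi>_def exp_small_in_def)
    fix \<psi> k assume \<psi>: "\<psi> \<in> C n" "\<psi> \<bullet>c \<psi> = 1" and k: "int k \<le> h n"
    let ?\<E> = "error_channel (2 ^ n) (N n) (lam n) (E n)" and ?P = "ketbra \<psi>"
    show "psd (2 ^ n) (R n ((?\<E> ^^ k) ?P) - complex_of_real (1 - \<xi> n) \<cdot>\<^sub>m ?P)"
    proof (cases "\<xi>\<^sub>0 n \<le> 1")
      case True
      then show ?thesis using tol[OF n \<psi> k] by (simp add: \<xi>_def)
    next
      \<comment> \<open>Here the cap is active and \<open>\<xi> n = 1\<close>: the subtracted term
        vanishes, and only positivity of the recovered state remains to be shown.\<close>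
      case False
      have c: "\<psi> \<in> carrier_vec (2 ^ n)" by (rule codespace_carrier[OF assms(2)[OF n] \<psi>(1)])
      have "psd (2 ^ n) ((?\<E> ^^ k) ?P)"
        by (induction k) (auto simp: psd_ketbra[OF c] psd_error_channel[OF assms(4)[OF n]])
      then have RP: "psd (2 ^ n) (R n ((?\<E> ^^ k) ?P))"
        using assms(6)[OF n] completely_positive_psd by (auto simp: recovery_map_def cptp_def)
      have "R n ((?\<E> ^^ k) ?P) - complex_of_real (1 - \<xi> n) \<cdot>\<^sub>m ?P = R n ((?\<E> ^^ k) ?P)"
        using False psd_carrier[OF RP] psd_carrier[OF psd_ketbra[OF c]]
        by (intro eq_matI) (auto simp: \<xi>_def)
      then show ?thesis using RP by simp
    qed
  qed
  ultimately show ?thesis by blast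
qed

end
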